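(* Let $\mathcal{A}$ be a unital $C^*$-algebra, let $a\in\mathcal{A}$ be a positive and invertible element, let $\lambda\in[0,1]$ and let $x,y\in\mathcal{A}$. The following statements are equivalent: 1) $x\perp_{a,\lambda}y$; 2) for each $\theta\in[0,2\pi)$ there exists $\varphi\in\mathcal{S}_a(\mathcal{A})$ such that $$\lambda\varphi(x^*ax)+(1-\lambda)|\varphi(ax)|^2=\|x\|_{a,\lambda}^2$$ and $$\mathrm{Re}\Big(e^{i\theta}\big(\lambda\varphi(x^*ay)+(1-\lambda)\overline{\varphi(ax)}\,\varphi(ay)\big)\Big)\ge 0.$$
   Context: $\mathcal{S}_a(\mathcal{A})=\{\varphi\in\mathcal{A}' : \varphi\ge 0,\ \varphi(a)=1\}$, where $\mathcal{A}'$ is the topological dual of $\mathcal{A}$. For $x\in\mathcal{A}$, $\|x\|_{a,\lambda}=\sup\{\sqrt{\lambda\varphi(x^*ax)+(1-\lambda)|\varphi(ax)|^2} : \varphi\in\mathcal{S}_a(\mathcal{A})\}$. The element $x$ is $(a,\lambda)$-Birkhoff-James orthogonal to $y$, written $x\perp_{a,\lambda}y$, if $\|x+\xi y\|_{a,\lambda}\ge\|x\|_{a,\lambda}$ for all $\xi\in\mathbb{C}$. *)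

theory Defs
  imports "HOL-Analysis.Analysis"
begin

text \<open>
  Unital (complex) C*-algebras. The ring, norm, unit and completeness come from the library's
  real classes; complex scalar multiplication is required to extend the real one. As usual the
  algebra is nonzero (\<open>0 \<noteq> 1\<close> holds in every \<^class>\<open>real_normed_algebra_1\<close>); its axiom
  \<open>norm 1 = 1\<close> is no restriction, because it follows from \<open>0 \<noteq> 1\<close> and the C*-identity.
\<close>

class unital_cstar_algebra = real_normed_algebra_1 + banach +
  fixes scaleC :: "complex \<Rightarrow> 'a \<Rightarrow> 'a" (infixr "*\<^sub>C" 75)
    and adj :: "'a \<Rightarrow> 'a"
  assumes scaleR_eq_scaleC: "r *\<^sub>R x = complex_of_real r *\<^sub>C x"
    and scaleC_add_right: "c *\<^sub>C (x + y) = c *\<^sub>C x + c *\<^sub>C y"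
    and scaleC_add_left: "(c + d) *\<^sub>C x = c *\<^sub>C x + d *\<^sub>C x"
    and scaleC_scaleC: "c *\<^sub>C (d *\<^sub>C x) = (c * d) *\<^sub>C x"
    and mult_scaleC_left: "(c *\<^sub>C x) * y = c *\<^sub>C (x * y)"
    and mult_scaleC_right: "x * (c *\<^sub>C y) = c *\<^sub>C (x * y)"
    and norm_scaleC: "norm (c *\<^sub>C x) = cmod c * norm x"
    and adj_adj: "adj (adj x) = x"
    and adj_add: "adj (x + y) = adj x + adj y"
    and adj_scaleC: "adj (c *\<^sub>C x) = cnj c *\<^sub>C adj x"
    and adj_mult: "adj (x * y) = adj y * adj x"
    and cstar_identity: "norm (adj x * x) = (norm x)\<^sup>2"

instantiation complex :: unital_cstar_algebra
begin

definition "scaleC c (z::complex) = c * z"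
definition "adj (z::complex) = cnj z"

instance
  by standard
    (simp_all add: scaleC_complex_def adj_complex_def scaleR_conv_of_real algebra_simps
      norm_mult power2_eq_square)

end

definition invertible_elem :: "'a::monoid_mult \<Rightarrow> bool" where
  "invertible_elem x \<longleftrightarrow> (\<exists>y. x * y = 1 \<and> y * x = 1)"

definition spectrum :: "'a::unital_cstar_algebra \<Rightarrow> complex set" where
  "spectrum x = {z. \<not> invertible_elem (x - z *\<^sub>C 1)}"

definition positive_elem :: "'a::unital_cstar_algebra \<Rightarrow> bool" where
  "positive_elem x \<longleftrightarrow> adj x = x \<and> spectrum x \<subseteq> complex_of_real ` {0..}"

definition topological_dual :: "('a::unital_cstar_algebra \<Rightarrow> complex) set" where
  "topological_dual = {\<phi>. Vector_Spaces.linear scaleC (*) \<phi> \<and> continuous_on UNIV \<phi>}"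

definition positive_functional :: "('a::unital_cstar_algebra \<Rightarrow> complex) \<Rightarrow> bool" where
  "positive_functional \<phi> \<longleftrightarrow> (\<forall>x. positive_elem x \<longrightarrow> \<phi> x \<in> complex_of_real ` {0..})"

definition a_states :: "'a::unital_cstar_algebra \<Rightarrow> ('a \<Rightarrow> complex) set" where
  "a_states a = {\<phi> \<in> topological_dual. positive_functional \<phi> \<and> \<phi> a = 1}"

text \<open>
  For positive \<open>a\<close> and \<open>\<phi> \<in> a_states a\<close> the number \<open>\<phi> (adj x * a * x)\<close> is real and nonnegative,
  so \<^const>\<open>Re\<close> below only converts its type. If moreover \<open>a\<close> is invertible, the set is nonempty
  and bounded above, so that the supremum is a genuine one.
\<close>

definition al_norm :: "'a::unital_cstar_algebra \<Rightarrow> real \<Rightarrow> 'a \<Rightarrow> real" where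
  "al_norm a l x =
     (SUP \<phi>\<in>a_states a. sqrt (l * Re (\<phi> (adj x * a * x)) + (1 - l) * (cmod (\<phi> (a * x)))\<^sup>2))"

definition al_orthogonal :: "'a::unital_cstar_algebra \<Rightarrow> real \<Rightarrow> 'a \<Rightarrow> 'a \<Rightarrow> bool" where
  "al_orthogonal a l x y \<longleftrightarrow> (\<forall>\<xi>::complex. al_norm a l (x + \<xi> *\<^sub>C y) \<ge> al_norm a l x)"

end

theory Submission
  imports Defs
begin

text \<open>
  For a state \<open>\<phi>\<close> let \<open>Q\<^sub>\<phi>(x) = \<lambda> \<phi>(x\<^sup>* a x) + (1 - \<lambda>) \<bar>\<phi>(a x)\<bar>\<^sup>2\<close>, so that the squared norm of \<open>x\<close> is the
  supremum of \<open>Q\<^sub>\<phi>(x)\<close> over all states, and let \<open>B\<^sub>\<phi>(x,y)\<close> be the sesquilinear form that belongs to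
  \<open>Q\<^sub>\<phi>\<close>. Then \<open>Q\<^sub>\<phi>(x + \<xi> y) = Q\<^sub>\<phi>(x) + 2 Re (\<xi> B\<^sub>\<phi>(x,y)) + \<bar>\<xi>\<bar>\<^sup>2 Q\<^sub>\<phi>(y)\<close>, with \<open>Q\<^sub>\<phi>(y) \<ge> 0\<close>
  (\<open>al_quad_add\<close>, \<open>al_quad_nonneg\<close>).

  If \<open>\<xi> = \<bar>\<xi>\<bar> e\<^bsup>i\<theta>\<^esup>\<close>, a norming state for \<open>x\<close> with \<open>Re (e\<^bsup>i\<theta>\<^esup> B\<^sub>\<phi>(x,y)) \<ge> 0\<close> therefore shows that
  the norm of \<open>x + \<xi> y\<close> is at least that of \<open>x\<close>. Conversely, let \<open>x\<close> be orthogonal to \<open>y\<close>. For small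
  \<open>t > 0\<close>, a state that almost norms \<open>x + t e\<^bsup>i\<theta>\<^esup> y\<close> almost norms \<open>x\<close> and satisfies the sign condition
  up to a small error (\<open>al_orthogonal_imp_approx\<close>). The states form a compact set for pointwise
  convergence (\<open>compact_a_states\<close>), so there is a state with no error (\<open>al_orthogonal_imp_state\<close>).

  This needs that \<open>Q\<^sub>\<phi>\<close> is nonnegative and bounded and that states exist, hence some theory of
  C*-algebras, in which positivity is a condition on the spectrum. Its cornerstone is that the
  norm of a self-adjoint element or its negative lies in the spectrum
  (\<open>norm_selfadjoint_in_spectrum\<close>). It turns positivity into a norm condition, which makes the
  positive elements a convex cone. That \<open>c\<^sup>* c\<close> is positive (\<open>positive_elem_adj_mult_self\<close>) follows from
  resolvent estimates without a continuous functional calculus; with a square root of \<open>a\<close> it yields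
  \<open>x\<^sup>* a x \<ge> 0\<close> (\<open>positive_elem_sandwich\<close>). States exist by the Hahn-Banach theorem
  (\<open>a_states_nonempty\<close>).
\<close>

section \<open>Complex scalars, the involution and invertible elements\<close>

interpretation cvs: vector_space "scaleC :: complex \<Rightarrow> 'a::unital_cstar_algebra \<Rightarrow> 'a"
proof
  show "1 *\<^sub>C x = x" for x :: 'a
    using scaleR_eq_scaleC[of 1 x] by simp
qed (simp_all add: scaleC_add_right scaleC_add_left scaleC_scaleC)

lemma adj_minus: "adj (- x) = - adj (x::'a::unital_cstar_algebra)"
  using adj_scaleC[of "-1" x] by simp

lemma adj_diff: "adj (x - y) = adj x - adj (y::'a::unital_cstar_algebra)"
  using adj_add[of x "-y"] by (simp add: adj_minus)

lemma adj_scaleR: "adj (r *\<^sub>R x) = r *\<^sub>R adj (x::'a::unital_cstar_algebra)"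
  by (simp add: scaleR_eq_scaleC adj_scaleC)

lemma adj_zero: "adj (0::'a::unital_cstar_algebra) = 0"
  using adj_minus[of "0::'a"] adj_diff[of "0::'a" 0] by simp

lemma adj_one: "adj (1::'a::unital_cstar_algebra) = 1"
  by (metis adj_adj adj_mult mult.left_neutral mult.right_neutral)

lemmas adj_simps = adj_adj adj_minus adj_diff adj_add adj_scaleC adj_scaleR adj_mult adj_zero adj_one

lemma norm_adj: "norm (adj x) = norm (x::'a::unital_cstar_algebra)"
proof -
  have le: "norm x \<le> norm (adj x)" for x :: 'a
  proof (cases "x = 0")
    case False
    have "norm x * norm x = norm (adj x * x)"
      by (simp add: cstar_identity power2_eq_square)
    also have "\<dots> \<le> norm (adj x) * norm x"
      by (rule norm_mult_ineq)
    finally show ?thesis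
      using False by simp
  qed simp
  show ?thesis
    using le[of x] le[of "adj x"] by (simp add: adj_adj)
qed

lemma norm_square_selfadjoint:
  fixes h :: "'a::unital_cstar_algebra"
  assumes "adj h = h"
  shows "norm (h * h) = (norm h)\<^sup>2"
  using cstar_identity[of h] assms by simp

lemma scaleC_ii_mult: "(\<i> *\<^sub>C x) * (\<i> *\<^sub>C y) = - (x * (y::'a::unital_cstar_algebra))"
  by (simp add: mult_scaleC_left mult_scaleC_right scaleC_scaleC)

lemma invertible_elem_mult:
  assumes "invertible_elem (x::'a::monoid_mult)" "invertible_elem y"
  shows "invertible_elem (x * y)"
proof -
  obtain x' y' where "x * x' = 1" "x' * x = 1" "y * y' = 1" "y' * y = 1"
    using assms by (auto simp: invertible_elem_def)
  then have "(x * y) * (y' * x') = 1" "(y' * x') * (x * y) = 1"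
    by (metis mult.assoc mult.right_neutral)+
  then show ?thesis
    by (auto simp: invertible_elem_def)
qed

lemma invertible_elem_scaleC:
  fixes x :: "'a::unital_cstar_algebra"
  assumes "c \<noteq> 0"
  shows "invertible_elem (c *\<^sub>C x) \<longleftrightarrow> invertible_elem x"
proof -
  have scale: "invertible_elem (c *\<^sub>C x)" if "c \<noteq> 0" "invertible_elem x" for c and x :: 'a
  proof -
    obtain y where "x * y = 1" "y * x = 1"
      using \<open>invertible_elem x\<close> by (auto simp: invertible_elem_def)
    then have "(c *\<^sub>C x) * (inverse c *\<^sub>C y) = 1" "(inverse c *\<^sub>C y) * (c *\<^sub>C x) = 1"
      using \<open>c \<noteq> 0\<close> by (simp_all add: mult_scaleC_left mult_scaleC_right)
    then show ?thesis
      by (auto simp: invertible_elem_def)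
  qed
  show ?thesis
    using scale[of c x] scale[of "inverse c" "c *\<^sub>C x"] assms by auto
qed

text \<open>The Neumann series.\<close>

lemma invertible_elem_one_minus:
  fixes x :: "'a::{real_normed_algebra_1,banach}"
  assumes "norm x < 1"
  shows "invertible_elem (1 - x)"
proof -
  have "summable (\<lambda>n. norm (x ^ n))"
    by (rule summable_comparison_test'[of "\<lambda>n. norm x ^ n" 0])
      (use assms in \<open>auto simp: summable_geometric norm_power_ineq\<close>)
  then have sm: "summable (\<lambda>n. x ^ n)"
    by (rule summable_norm_cancel)
  define s where "s = (\<Sum>n. x ^ n)"
  have s1: "s = 1 + (\<Sum>n. x ^ Suc n)"
    using suminf_split_head[OF sm] by (simp add: s_def)
  have "(\<Sum>n. x ^ Suc n) = x * s"
    using suminf_mult[OF sm, of x] by (simp add: s_def)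
  moreover have "(\<Sum>n. x ^ Suc n) = s * x"
    using suminf_mult2[OF sm, of x] by (simp add: s_def power_commutes)
  ultimately have "(1 - x) * s = 1" "s * (1 - x) = 1"
    using s1 by (simp_all add: left_diff_distrib right_diff_distrib)
  then show ?thesis
    by (auto simp: invertible_elem_def)
qed

lemma invertible_elem_perturb:
  fixes x y :: "'a::unital_cstar_algebra"
  assumes "x * k = 1" "k * x = 1" "norm (x - y) * norm k < 1"
  shows "invertible_elem y"
proof -
  have "norm ((x - y) * k) < 1"
    using norm_mult_ineq[of "x - y" k] assms(3) by linarith
  then have "invertible_elem (1 - (x - y) * k)"
    by (rule invertible_elem_one_minus)
  moreover have "invertible_elem x"
    using assms by (auto simp: invertible_elem_def)
  moreover have "(1 - (x - y) * k) * x = y"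
    using assms by (simp add: left_diff_distrib mult.assoc)
  ultimately show ?thesis
    by (metis invertible_elem_mult)
qed

lemma inverse_selfadjoint:
  fixes x :: "'a::unital_cstar_algebra"
  assumes "x * k = 1" "k * x = 1" "adj x = x"
  shows "adj k = k"
proof -
  have "x * adj k = 1"
    using arg_cong[OF assms(2), of adj] assms(3) by (simp add: adj_mult adj_one)
  then show ?thesis
    by (metis assms(2) mult.assoc mult.left_neutral mult.right_neutral)
qed

section \<open>The spectrum of a self-adjoint element\<close>

lemma norm_spectrum_le:
  fixes x :: "'a::unital_cstar_algebra"
  assumes "z \<in> spectrum x"
  shows "cmod z \<le> norm x"
proof (rule ccontr)
  assume "\<not> ?thesis"
  then have "z \<noteq> 0" and less: "norm x < cmod z"
    by auto
  then have "norm (inverse z *\<^sub>C x) < 1"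
    by (simp add: norm_scaleC norm_inverse inverse_eq_divide norm_divide divide_less_eq)
  then have "invertible_elem ((- z) *\<^sub>C (1 - inverse z *\<^sub>C x))"
    using \<open>z \<noteq> 0\<close> invertible_elem_scaleC[of "- z"] invertible_elem_one_minus by fastforce
  also have "(- z) *\<^sub>C (1 - inverse z *\<^sub>C x) = x - z *\<^sub>C 1"
    using \<open>z \<noteq> 0\<close> by (simp add: cvs.scale_right_diff_distrib)
  finally show False
    using assms by (simp add: spectrum_def)
qed

lemma spectrum_translate:
  fixes x :: "'a::unital_cstar_algebra"
  shows "z \<in> spectrum (x + w *\<^sub>C 1) \<longleftrightarrow> z - w \<in> spectrum x"
  by (simp add: spectrum_def cvs.scale_left_diff_distrib algebra_simps)

lemma spectrum_uminus:
  fixes x :: "'a::unital_cstar_algebra"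
  shows "z \<in> spectrum (- x) \<longleftrightarrow> - z \<in> spectrum x"
proof -
  have "- x - z *\<^sub>C 1 = (-1) *\<^sub>C (x - (- z) *\<^sub>C 1)"
    by (simp add: cvs.scale_right_diff_distrib)
  then show ?thesis
    using invertible_elem_scaleC[of "-1" "x - (- z) *\<^sub>C 1"] by (simp add: spectrum_def)
qed

lemma spectrum_reflect:
  fixes x :: "'a::unital_cstar_algebra"
  shows "z \<in> spectrum (t *\<^sub>R 1 - x) \<longleftrightarrow> complex_of_real t - z \<in> spectrum x"
  using spectrum_translate[of z "- x" "complex_of_real t"]
  by (simp add: spectrum_uminus scaleR_eq_scaleC)

text \<open>
  If \<open>s + i t\<close> lies in the spectrum of \<open>h\<close>, then \<open>s + i (t + r)\<close> lies in that of \<open>h + i r\<close>, whose norm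
  is at most \<open>\<surd>(\<parallel>h\<parallel>\<^sup>2 + r\<^sup>2)\<close> by the C*-identity; letting \<open>r\<close> tend to \<open>\<plusminus>\<infinity>\<close> forces \<open>t = 0\<close>.
\<close>

lemma spectrum_selfadjoint_real:
  fixes h :: "'a::unital_cstar_algebra"
  assumes "adj h = h" "z \<in> spectrum h"
  shows "Im z = 0"
proof -
  have bd: "2 * r * Im z \<le> (norm h)\<^sup>2" for r :: real
  proof -
    have ii: "\<i> * r * (\<i> * r) = - (complex_of_real r * complex_of_real r)"
      by (simp add: algebra_simps)
    have eq: "adj (h + (\<i> * r) *\<^sub>C 1) * (h + (\<i> * r) *\<^sub>C 1) = h * h + r\<^sup>2 *\<^sub>R 1"
      by (simp add: adj_simps assms(1) distrib_left left_diff_distrib mult_scaleC_left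
          mult_scaleC_right cvs.scale_right_diff_distrib scaleR_eq_scaleC power2_eq_square ii)
    have "z + \<i> * r \<in> spectrum (h + (\<i> * r) *\<^sub>C 1)"
      using assms(2) by (simp add: spectrum_translate)
    then have "cmod (z + \<i> * r) \<le> norm (h + (\<i> * r) *\<^sub>C 1)"
      by (rule norm_spectrum_le)
    then have "(cmod (z + \<i> * r))\<^sup>2 \<le> (norm (h + (\<i> * r) *\<^sub>C 1))\<^sup>2"
      by (simp add: power_mono)
    also have "\<dots> = norm (adj (h + (\<i> * r) *\<^sub>C 1) * (h + (\<i> * r) *\<^sub>C 1))"
      by (simp add: cstar_identity)
    also have "\<dots> = norm (h * h + r\<^sup>2 *\<^sub>R 1)"
      by (simp only: eq)
    also have "\<dots> \<le> (norm h)\<^sup>2 + r\<^sup>2"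
      using norm_triangle_ineq[of "h * h" "r\<^sup>2 *\<^sub>R 1"] norm_square_selfadjoint[OF assms(1)]
      by simp
    finally have "(Re z)\<^sup>2 + (Im z + r)\<^sup>2 \<le> (norm h)\<^sup>2 + r\<^sup>2"
      by (simp add: cmod_power2)
    moreover have "(Im z + r)\<^sup>2 = (Im z)\<^sup>2 + 2 * r * Im z + r\<^sup>2"
      by (simp add: power2_sum)
    ultimately show ?thesis
      using zero_le_power2[of "Re z"] zero_le_power2[of "Im z"] by linarith
  qed
  show ?thesis
  proof (rule ccontr)
    assume "Im z \<noteq> 0"
    then show False
      using bd[of "((norm h)\<^sup>2 + 1) / (2 * Im z)"] by simp
  qed
qed

text \<open>
  Rickart's argument, which gives the spectral radius formula without complex analysis. The
  inverse \<open>R(z)\<close> of \<open>1 - z x\<close> is uniformly continuous on the closed disc, so \<open>R(z)\<close> and \<open>R(r z)\<close>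
  are uniformly close on the unit circle for some \<open>r < 1\<close>. The mean of the inverses at \<open>z\<close> and at
  \<open>-z\<close> is the inverse of \<open>1 - z\<^sup>2 x\<^sup>2\<close>, so passing to \<open>x\<^sup>2\<close> and \<open>r\<^sup>2\<close> preserves this closeness.
  After \<open>k\<close> squarings the second inverse is close to \<open>1\<close>, hence so is that of \<open>1 - x\<^bsup>2^k\<^esup>\<close>,
  which forces \<open>x\<^bsup>2^k\<^esup>\<close> to have norm below \<open>1\<close>.
\<close>

lemma power_norm_less_one_if_resolvent:
  fixes x :: "'a::unital_cstar_algebra"
  assumes inv: "\<And>z. cmod z \<le> 1 \<Longrightarrow> invertible_elem (1 - z *\<^sub>C x)" and nx: "norm x \<le> 1"
  shows "\<exists>k. norm (x ^ (2 ^ k)) < 1"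
proof -
  have "\<forall>z. \<exists>y. cmod z \<le> 1 \<longrightarrow> (1 - z *\<^sub>C x) * y = 1 \<and> y * (1 - z *\<^sub>C x) = 1"
    using inv unfolding invertible_elem_def by blast
  then obtain R where R: "\<And>z. cmod z \<le> 1 \<Longrightarrow> (1 - z *\<^sub>C x) * R z = 1"
      "\<And>z. cmod z \<le> 1 \<Longrightarrow> R z * (1 - z *\<^sub>C x) = 1"
    by metis
  have diff: "norm (R w - R z) \<le> cmod (w - z) * norm (R w) * norm (R z)"
    if "cmod w \<le> 1" "cmod z \<le> 1" for w z
  proof -
    have "R w - R z = R w * ((1 - z *\<^sub>C x) - (1 - w *\<^sub>C x)) * R z"
    proof -
      have "R w * (1 - z *\<^sub>C x) * R z = R w" "R w * (1 - w *\<^sub>C x) * R z = R z"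
        using R[of w] R[of z] that by (simp_all add: mult.assoc)
      then show ?thesis
        by (simp only: left_diff_distrib right_diff_distrib)
    qed
    also have "(1 - z *\<^sub>C x) - (1 - w *\<^sub>C x) = (w - z) *\<^sub>C x"
      by (simp add: cvs.scale_left_diff_distrib)
    also have "norm (R w * ((w - z) *\<^sub>C x) * R z) \<le> norm (R w) * norm ((w - z) *\<^sub>C x) * norm (R z)"
      by (meson mult_right_mono norm_ge_zero norm_mult_ineq order_trans)
    also have "\<dots> \<le> norm (R w) * (cmod (w - z) * 1) * norm (R z)"
      using nx by (intro mult_right_mono mult_left_mono) (auto simp: norm_scaleC mult_left_le)
    finally show ?thesis
      by (simp add: mult_ac)
  qed
  have "continuous_on (cball 0 1) R"
    unfolding continuous_on_iff
  proof (intro ballI allI impI)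
    fix z :: complex and e :: real
    assume z: "z \<in> cball 0 1" and e: "0 < e"
    define K where "K = norm (R z) + 1"
    have K: "K \<ge> 1" "norm (R z) \<le> K"
      by (auto simp: K_def)
    show "\<exists>d>0. \<forall>w\<in>cball 0 1. dist w z < d \<longrightarrow> dist (R w) (R z) < e"
    proof (intro exI[of _ "min (1 / (2 * K)) (e / (2 * K * K))"] conjI ballI impI)
      show "0 < min (1 / (2 * K)) (e / (2 * K * K))"
        using K e by simp
      fix w assume w: "w \<in> cball 0 1" "dist w z < min (1 / (2 * K)) (e / (2 * K * K))"
      then have w1: "cmod (w - z) * (2 * K) \<le> 1" and w2: "cmod (w - z) * (2 * K * K) < e"
        using K by (auto simp: dist_norm field_simps)
      have d: "norm (R w - R z) \<le> cmod (w - z) * norm (R w) * norm (R z)"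
        using diff w z by auto
      also have "\<dots> \<le> cmod (w - z) * norm (R w) * K"
        using K by (intro mult_left_mono) auto
      finally have d: "norm (R w - R z) \<le> cmod (w - z) * norm (R w) * K" .
      have "cmod (w - z) * (2 * K) * norm (R w) \<le> norm (R w)"
        using mult_right_mono[OF w1, of "norm (R w)"] by simp
      then have "2 * norm (R w - R z) \<le> norm (R w)"
        using d by (simp add: mult_ac)
      then have "norm (R w) \<le> 2 * K"
        using norm_triangle_sub[of "R w" "R z"] K by linarith
      then have "cmod (w - z) * norm (R w) * K \<le> cmod (w - z) * (2 * K) * K"
        using K by (intro mult_right_mono mult_left_mono) auto
      then show "dist (R w) (R z) < e"
        using d w2 by (simp add: dist_norm mult_ac)
    qed
  qed
  then have "uniformly_continuous_on (cball 0 1) R"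
    by (rule compact_uniformly_continuous) simp
  then obtain d where d: "d > 0"
      "\<And>z w. \<lbrakk>cmod z \<le> 1; cmod w \<le> 1; dist z w < d\<rbrakk> \<Longrightarrow> dist (R z) (R w) < 1/4"
    unfolding uniformly_continuous_on_def
    by (metis mem_cball_0 divide_pos_pos zero_less_numeral zero_less_one)
  define r where "r = max (1/2) (1 - d/2)"
  have r: "0 < r" "r < 1" "1 - r < d"
    using d(1) by (auto simp: r_def max_def)
  have close: "\<forall>z. cmod z = 1 \<longrightarrow> (\<exists>u v. (1 - z *\<^sub>C x ^ (2 ^ k)) * u = 1
      \<and> (1 - (z * r ^ (2 ^ k)) *\<^sub>C x ^ (2 ^ k)) * v = 1 \<and> norm (u - v) \<le> 1/4)" for k
  proof (induction k)
    case 0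
    show ?case
    proof (intro allI impI)
      fix z assume z: "cmod z = 1"
      have "dist z (z * r) = cmod (z * (1 - r))"
        by (simp add: dist_norm algebra_simps)
      also have "\<dots> = 1 - r"
        using z r
        by (metis abs_of_pos diff_gt_0_iff_gt mult_1 norm_mult norm_of_real of_real_1 of_real_diff)
      finally have "dist (R z) (R (z * r)) < 1/4"
        using d(2)[of z "z * r"] z r by (simp add: norm_mult)
      then show "\<exists>u v. (1 - z *\<^sub>C x ^ 2 ^ 0) * u = 1 \<and>
          (1 - (z * r ^ 2 ^ 0) *\<^sub>C x ^ 2 ^ 0) * v = 1 \<and> norm (u - v) \<le> 1/4"
        using R(1)[of z] R(1)[of "z * r"] z r
        by (intro exI[of _ "R z"] exI[of _ "R (z * r)"]) (simp add: dist_norm norm_mult)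
    qed
  next
    case (Suc k)
    define y where "y = x ^ (2 ^ k)"
    define s where "s = r ^ (2 ^ k)"
    have y2: "x ^ (2 ^ Suc k) = y * y" and s2: "r ^ (2 ^ Suc k) = s * s"
      by (simp_all add: y_def s_def mult_2 power_add)
    have IH: "\<exists>u v. (1 - z *\<^sub>C y) * u = 1 \<and> (1 - (z * s) *\<^sub>C y) * v = 1 \<and> norm (u - v) \<le> 1/4"
      if "cmod z = 1" for z
      using Suc that by (simp add: y_def s_def)
    have mean: "(1 - (z * z) *\<^sub>C (y * y)) * ((1/2) *\<^sub>R (u + u')) = 1"
      if "(1 - z *\<^sub>C y) * u = 1" "(1 - (- z) *\<^sub>C y) * u' = 1" for z u u'
    proof -
      have "(1 - (- z) *\<^sub>C y) * (1 - z *\<^sub>C y) = 1 - (z * z) *\<^sub>C (y * y)"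
           "(1 - z *\<^sub>C y) * (1 - (- z) *\<^sub>C y) = 1 - (z * z) *\<^sub>C (y * y)"
        by (simp_all add: left_diff_distrib right_diff_distrib distrib_left distrib_right
            mult_scaleC_left mult_scaleC_right cvs.scale_right_diff_distrib cvs.scale_right_distrib)
      then have "(1 - (z * z) *\<^sub>C (y * y)) * u = 1 - (- z) *\<^sub>C y"
           "(1 - (z * z) *\<^sub>C (y * y)) * u' = 1 - z *\<^sub>C y"
        using that by (metis mult.assoc mult.right_neutral)+
      then have "(1 - (z * z) *\<^sub>C (y * y)) * (u + u') = 2 *\<^sub>R 1"
        by (simp add: distrib_left scaleR_2)
      then show ?thesis
        by simp
    qed
    show ?case
    proof (intro allI impI)
      fix w assume w: "cmod w = 1"
      define z where "z = csqrt w"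
      have z: "z * z = w" "cmod z = 1"
        using w by (simp_all add: z_def flip: power2_eq_square)
      obtain u v where uv: "(1 - z *\<^sub>C y) * u = 1" "(1 - (z * s) *\<^sub>C y) * v = 1"
          "norm (u - v) \<le> 1/4"
        using IH[of z] z by auto
      obtain u' v' where uv': "(1 - (- z) *\<^sub>C y) * u' = 1" "(1 - (- z * s) *\<^sub>C y) * v' = 1"
          "norm (u' - v') \<le> 1/4"
        using IH[of "- z"] z by auto
      have "norm ((1/2) *\<^sub>R (u + u') - (1/2) *\<^sub>R (v + v')) = 1/2 * norm ((u - v) + (u' - v'))"
        by (simp flip: scaleR_diff_right) (simp add: algebra_simps)
      also have "\<dots> \<le> 1/4"
        using norm_triangle_ineq[of "u - v" "u' - v'"] uv(3) uv'(3) by linarith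
      finally have "norm ((1/2) *\<^sub>R (u + u') - (1/2) *\<^sub>R (v + v')) \<le> 1/4" .
      moreover have "(1 - w *\<^sub>C (y * y)) * ((1/2) *\<^sub>R (u + u')) = 1"
        using mean[OF uv(1) uv'(1)] z by simp
      moreover have "(1 - (w * (s * s)) *\<^sub>C (y * y)) * ((1/2) *\<^sub>R (v + v')) = 1"
        using mean[of "z * s" v v'] uv uv' by (simp add: mult_ac flip: z(1))
      ultimately show "\<exists>u v. (1 - w *\<^sub>C x ^ 2 ^ Suc k) * u = 1 \<and>
          (1 - (w * r ^ 2 ^ Suc k) *\<^sub>C x ^ 2 ^ Suc k) * v = 1 \<and> norm (u - v) \<le> 1/4"
        unfolding y2 s2 of_real_power[symmetric] of_real_mult by blast
    qed
  qed
  obtain k where "r ^ k < 1/9"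
    using real_arch_pow_inv[of "1/9" r] r by auto
  moreover have "r ^ (2 ^ k) \<le> r ^ k"
    using r by (intro power_decreasing) (auto intro: less_imp_le)
  ultimately have "r ^ (2 ^ k) \<le> 1/9"
    by linarith
  then have s: "r ^ (2 ^ k) \<le> 1/9" "0 \<le> r ^ (2 ^ k)"
    using r by auto
  define y where "y = x ^ (2 ^ k)"
  define t where "t = r ^ (2 ^ k)"
  have y1: "norm y \<le> 1"
    unfolding y_def using norm_power_ineq[of x "2 ^ k"] nx
    by (meson norm_ge_zero order_trans power_le_one)
  obtain u v where u: "(1 - y) * u = 1" and v: "(1 - t *\<^sub>R y) * v = 1" and uv: "norm (u - v) \<le> 1/4"
    using close[rule_format, of 1 k] by (auto simp: y_def t_def scaleR_eq_scaleC)
  have "v - 1 = t *\<^sub>R (y * v)"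
    using v by (simp add: left_diff_distrib algebra_simps)
  then have "norm (v - 1) \<le> t * (norm y * norm v)"
    using s norm_mult_ineq[of y v] by (simp add: t_def mult_left_mono)
  also have "\<dots> \<le> 1/9 * (1 * norm v)"
    using s y1 by (intro mult_mono) (auto simp: t_def)
  also have "norm v \<le> norm (v - 1) + 1"
    using norm_triangle_sub[of v 1] by simp
  finally have "norm (v - 1) \<le> 1/8"
    by simp
  then have u1: "norm (u - 1) \<le> 3/8"
    using norm_triangle_ineq[of "u - v" "v - 1"] uv by simp
  have "y = (1 - y) * (u - 1)"
    using u by (simp add: right_diff_distrib)
  then have "norm y \<le> norm (1 - y) * norm (u - 1)"
    by (metis norm_mult_ineq)
  also have "\<dots> \<le> 2 * (3/8)"
    using u1 y1 norm_triangle_ineq4[of 1 y] by (intro mult_mono) auto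
  finally have "norm y < 1"
    by simp
  then show ?thesis
    by (auto simp: y_def)
qed

text \<open>
  For self-adjoint \<open>g\<close> of norm \<open>1\<close> all \<open>g\<^bsup>2^k\<^esup>\<close> have norm \<open>1\<close>, so the preceding lemma exhibits a \<open>z\<close>
  in the closed disc for which \<open>1 - z g\<close> is not invertible. As the spectrum of \<open>g\<close> is real and
  lies in the disc, \<open>z = \<plusminus>1\<close>.
\<close>

lemma norm_selfadjoint_in_spectrum:
  fixes h :: "'a::unital_cstar_algebra"
  assumes sa: "adj h = h"
  shows "complex_of_real (norm h) \<in> spectrum h \<or> complex_of_real (- norm h) \<in> spectrum h"
proof (cases "h = 0")
  case True
  then show ?thesis
    by (simp add: spectrum_def invertible_elem_def)
next
  case False
  define N where "N = norm h"
  have N: "N > 0"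
    using False by (simp add: N_def)
  define g where "g = (1 / N) *\<^sub>R h"
  have g: "adj g = g" "norm g = 1"
    using N by (simp_all add: g_def adj_scaleR sa) (simp add: N_def)
  show ?thesis
  proof (rule ccontr)
    assume not: "\<not> ?thesis"
    have "invertible_elem (1 - z *\<^sub>C g)" if z: "cmod z \<le> 1" for z
    proof (cases "z = 0")
      case True
      then show ?thesis
        by (auto simp: invertible_elem_def)
    next
      case False
      have "N / z \<notin> spectrum h"
      proof
        assume sp: "N / z \<in> spectrum h"
        then have im: "Im (N / z) = 0"
          using spectrum_selfadjoint_real[OF sa] by blast
        have "N / cmod z \<le> N"
          using norm_spectrum_le[OF sp] N by (simp add: norm_divide N_def)
        then have "cmod z = 1"
          using z N False by (simp add: field_simps)
        then have "\<bar>Re (N / z)\<bar> = N"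
          using im N by (metis abs_of_pos cmod_eq_Re div_by_1 norm_divide norm_of_real)
        then have "N / z = complex_of_real N \<or> N / z = complex_of_real (- N)"
          using im by (auto simp: complex_eq_iff abs_if split: if_splits)
        then show False
          using not sp by (auto simp: N_def)
      qed
      then have "invertible_elem (h - (N / z) *\<^sub>C 1)"
        by (simp add: spectrum_def)
      then have "invertible_elem ((- (z / N)) *\<^sub>C (h - (N / z) *\<^sub>C 1))"
        using invertible_elem_scaleC[of "- (z / N)"] False N by force
      also have "(- (z / N)) *\<^sub>C (h - (N / z) *\<^sub>C 1) = 1 - z *\<^sub>C g"
        using False N by (simp add: cvs.scale_right_diff_distrib g_def scaleR_eq_scaleC)
      finally show ?thesis .
    qed
    then obtain k where "norm (g ^ (2 ^ k)) < 1"
      using power_norm_less_one_if_resolvent[of g] g(2) by auto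
    moreover have "adj (g ^ (2 ^ k)) = g ^ (2 ^ k) \<and> norm (g ^ (2 ^ k)) = 1" for k
    proof (induction k)
      case (Suc k)
      have "g ^ (2 ^ Suc k) = g ^ (2 ^ k) * g ^ (2 ^ k)"
        by (simp add: mult_2 power_add)
      then show ?case
        using Suc by (simp add: adj_mult norm_square_selfadjoint)
    qed (simp add: g)
    ultimately show False
      by simp
  qed
qed

section \<open>Positive elements\<close>

lemma positive_elem_adj: "positive_elem h \<Longrightarrow> adj h = h"
  by (simp add: positive_elem_def)

lemma positive_elem_spectrum_nonneg:
  "positive_elem h \<Longrightarrow> complex_of_real r \<in> spectrum h \<Longrightarrow> 0 \<le> r"
  by (auto simp: positive_elem_def)

lemma positive_elemI_real:
  fixes h :: "'a::unital_cstar_algebra"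
  assumes "adj h = h" "\<And>r. complex_of_real r \<in> spectrum h \<Longrightarrow> 0 \<le> r"
  shows "positive_elem h"
  unfolding positive_elem_def
proof (intro conjI subsetI)
  fix z assume z: "z \<in> spectrum h"
  then have "z = complex_of_real (Re z)"
    using spectrum_selfadjoint_real[OF assms(1)] by (simp add: complex_eq_iff)
  then show "z \<in> complex_of_real ` {0..}"
    using assms(2)[of "Re z"] z by (metis atLeast_iff imageI)
qed (fact assms(1))

lemma positive_elemI_norm:
  fixes h :: "'a::unital_cstar_algebra"
  assumes "adj h = h" "norm (t *\<^sub>R 1 - h) \<le> t"
  shows "positive_elem h"
proof (rule positive_elemI_real)
  fix r assume "complex_of_real r \<in> spectrum h"
  then have "complex_of_real (t - r) \<in> spectrum (t *\<^sub>R 1 - h)"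
    by (simp add: spectrum_reflect)
  then have "\<bar>t - r\<bar> \<le> t"
    using norm_spectrum_le assms(2) by (metis norm_of_real order_trans real_norm_def)
  then show "0 \<le> r"
    by simp
qed (fact assms(1))

lemma positive_elem_norm_reflect:
  fixes h :: "'a::unital_cstar_algebra"
  assumes "positive_elem h" "norm h \<le> t"
  shows "norm (t *\<^sub>R 1 - h) \<le> t"
proof -
  define N where "N = norm (t *\<^sub>R 1 - h)"
  have "adj (t *\<^sub>R 1 - h) = t *\<^sub>R 1 - h"
    using assms(1) by (simp add: adj_simps positive_elem_adj)
  from norm_selfadjoint_in_spectrum[OF this]
  have "complex_of_real (t - N) \<in> spectrum h \<or> complex_of_real (t + N) \<in> spectrum h"
    by (simp add: spectrum_reflect N_def)
  then show ?thesis
  proof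
    assume "complex_of_real (t - N) \<in> spectrum h"
    then have "0 \<le> t - N"
      by (rule positive_elem_spectrum_nonneg[OF assms(1)])
    then show ?thesis
      by (simp add: N_def)
  next
    assume "complex_of_real (t + N) \<in> spectrum h"
    then have "\<bar>t + N\<bar> \<le> t"
      using norm_spectrum_le assms(2) by (metis norm_of_real order_trans real_norm_def)
    then show ?thesis
      by (simp add: N_def)
  qed
qed

lemma positive_elem_add:
  fixes g h :: "'a::unital_cstar_algebra"
  assumes "positive_elem g" "positive_elem h"
  shows "positive_elem (g + h)"
proof (rule positive_elemI_norm)
  show "adj (g + h) = g + h"
    using assms by (simp add: adj_add positive_elem_adj)
  have "norm ((norm g + norm h) *\<^sub>R 1 - (g + h))
      = norm ((norm g *\<^sub>R 1 - g) + (norm h *\<^sub>R 1 - h))"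
    by (simp add: scaleR_left_distrib algebra_simps)
  also have "\<dots> \<le> norm g + norm h"
    using assms by (intro norm_triangle_mono positive_elem_norm_reflect) auto
  finally show "norm ((norm g + norm h) *\<^sub>R 1 - (g + h)) \<le> norm g + norm h" .
qed

lemma positive_elem_scaleR:
  fixes h :: "'a::unital_cstar_algebra"
  assumes "positive_elem h" "0 \<le> r"
  shows "positive_elem (r *\<^sub>R h)"
proof (rule positive_elemI_norm)
  show "adj (r *\<^sub>R h) = r *\<^sub>R h"
    using assms by (simp add: adj_scaleR positive_elem_adj)
  have "norm ((r * norm h) *\<^sub>R 1 - r *\<^sub>R h) = r * norm (norm h *\<^sub>R 1 - h)"
    using assms(2) by (metis abs_of_nonneg norm_scaleR scaleR_diff_right scaleR_scaleR)
  also have "\<dots> \<le> r * norm h"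
    using assms by (intro mult_left_mono positive_elem_norm_reflect) auto
  finally show "norm ((r * norm h) *\<^sub>R 1 - r *\<^sub>R h) \<le> r * norm h" .
qed

lemma positive_elem_norm_plus:
  fixes h :: "'a::unital_cstar_algebra"
  assumes "adj h = h"
  shows "positive_elem (norm h *\<^sub>R 1 + h)"
  by (rule positive_elemI_norm[of _ "norm h"]) (use assms in \<open>auto simp: adj_simps\<close>)

lemma positive_elem_square:
  fixes w :: "'a::unital_cstar_algebra"
  assumes sa: "adj w = w"
  shows "positive_elem (w * w)"
proof (rule positive_elemI_real)
  show "adj (w * w) = w * w"
    using sa by (simp add: adj_mult)
  fix r assume r: "complex_of_real r \<in> spectrum (w * w)"
  define u where "u = csqrt (complex_of_real r)"
  have u2: "u * u = complex_of_real r"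
    by (simp add: u_def flip: power2_eq_square)
  have "w * w - complex_of_real r *\<^sub>C 1 = (w - u *\<^sub>C 1) * (w - (- u) *\<^sub>C 1)"
    by (simp add: left_diff_distrib distrib_left mult_scaleC_left mult_scaleC_right
        cvs.scale_right_diff_distrib u2)
  then have "u \<in> spectrum w \<or> - u \<in> spectrum w"
    using r invertible_elem_mult by (fastforce simp: spectrum_def)
  then have "Im u = 0"
    using spectrum_selfadjoint_real[OF sa] by fastforce
  then have "r = Re u * Re u"
    using arg_cong[OF u2, of Re] by simp
  then show "0 \<le> r"
    by simp
qed

text \<open>Norm bounds from order bounds: if \<open>0 \<le> h \<le> b\<close>, then \<open>\<parallel>h\<parallel> \<le> b\<close>.\<close>

lemma norm_le_if_positive_elem:
  fixes h :: "'a::unital_cstar_algebra"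
  assumes "positive_elem h" "positive_elem (b *\<^sub>R 1 - h)"
  shows "norm h \<le> b"
proof -
  from norm_selfadjoint_in_spectrum[OF positive_elem_adj[OF assms(1)]]
  have "complex_of_real (norm h) \<in> spectrum h"
    using positive_elem_spectrum_nonneg[OF assms(1), of "- norm h"] by auto
  then have "complex_of_real (b - norm h) \<in> spectrum (b *\<^sub>R 1 - h)"
    by (simp add: spectrum_reflect)
  then show ?thesis
    using positive_elem_spectrum_nonneg[OF assms(2)] by fastforce
qed

lemma spectrum_mult_commute:
  fixes x y :: "'a::unital_cstar_algebra"
  assumes "z \<in> spectrum (x * y)" "z \<noteq> 0"
  shows "z \<in> spectrum (y * x)"
proof (rule ccontr)
  assume "z \<notin> spectrum (y * x)"
  then obtain k where k: "(y * x - z *\<^sub>C 1) * k = 1" "k * (y * x - z *\<^sub>C 1) = 1"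
    by (auto simp: spectrum_def invertible_elem_def)
  define j where "j = inverse z *\<^sub>C (x * k * y - 1)"
  have "(x * y - z *\<^sub>C 1) * (x * k * y - 1) = x * ((y * x - z *\<^sub>C 1) * k) * y - x * y + z *\<^sub>C 1"
    by (simp add: left_diff_distrib right_diff_distrib mult.assoc mult_scaleC_left mult_scaleC_right
        cvs.scale_right_diff_distrib)
  then have 1: "(x * y - z *\<^sub>C 1) * j = 1"
    using assms(2) k by (simp add: j_def mult_scaleC_right)
  have "(x * k * y - 1) * (x * y - z *\<^sub>C 1) = x * (k * (y * x - z *\<^sub>C 1)) * y - x * y + z *\<^sub>C 1"
    by (simp add: left_diff_distrib right_diff_distrib mult.assoc mult_scaleC_left mult_scaleC_right
        cvs.scale_right_diff_distrib)
  then have 2: "j * (x * y - z *\<^sub>C 1) = 1"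
    using assms(2) k by (simp add: j_def mult_scaleC_left)
  from 1 2 assms(1) show False
    by (auto simp: spectrum_def invertible_elem_def)
qed

text \<open>An upper bound passes from \<open>d\<^sup>* d\<close> to \<open>d d\<^sup>*\<close>, since the spectra agree apart from \<open>0\<close>.\<close>

lemma positive_elem_bound_adj_mult_commute:
  fixes d :: "'a::unital_cstar_algebra"
  assumes "positive_elem (b *\<^sub>R 1 - adj d * d)" "0 \<le> b"
  shows "positive_elem (b *\<^sub>R 1 - d * adj d)"
proof (rule positive_elemI_real)
  show "adj (b *\<^sub>R 1 - d * adj d) = b *\<^sub>R 1 - d * adj d"
    by (simp add: adj_simps)
  fix r assume "complex_of_real r \<in> spectrum (b *\<^sub>R 1 - d * adj d)"
  then have sp: "complex_of_real (b - r) \<in> spectrum (d * adj d)"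
    by (simp add: spectrum_reflect)
  show "0 \<le> r"
  proof (cases "r = b")
    case False
    then have "complex_of_real (b - r) \<in> spectrum (adj d * d)"
      using spectrum_mult_commute[OF sp] by (metis eq_iff_diff_eq_0 of_real_eq_0_iff)
    then have "complex_of_real r \<in> spectrum (b *\<^sub>R 1 - adj d * d)"
      by (simp add: spectrum_reflect)
    then show ?thesis
      by (rule positive_elem_spectrum_nonneg[OF assms(1)])
  qed (use assms(2) in simp)
qed

text \<open>
  For \<open>h = c\<^sup>* c\<close> and \<open>k = (h + s)\<^sup>-\<^sup>1\<close> put \<open>d = c k\<close>. Completing the square gives
  \<open>d\<^sup>* d = k - s k\<^sup>2 = 1/(4s) - s (k - 1/(2s))\<^sup>2\<close>, so \<open>d\<^sup>* d\<close>, and with it \<open>d d\<^sup>*\<close>, is at most \<open>1/(4s)\<close>.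
  Since \<open>d\<^sup>* d + d d\<^sup>*\<close> is a sum of squares of self-adjoint elements, \<open>d\<^sup>* d\<close> is at least \<open>-1/(4s)\<close>,
  which bounds \<open>k\<close>.
\<close>

lemma norm_resolvent_adj_mult_self:
  fixes c k :: "'a::unital_cstar_algebra"
  assumes s: "s > 0"
    and k: "(adj c * c + s *\<^sub>R 1) * k = 1" "k * (adj c * c + s *\<^sub>R 1) = 1"
  shows "norm k * s \<le> 5/4"
proof -
  define h where "h = adj c * c"
  have h: "adj h = h"
    by (simp add: h_def adj_mult adj_adj)
  have ka: "adj k = k"
    by (rule inverse_selfadjoint[OF k]) (simp add: adj_simps)
  define b where "b = 1 / (4 * s)"
  have b: "b > 0"
    using s by (simp add: b_def)
  define d where "d = c * k"
  define g where "g = k - (1 / (2 * s)) *\<^sub>R 1"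
  have ga: "adj g = g"
    by (simp add: g_def adj_simps ka)
  have "k * (h * k) = k - s *\<^sub>R (k * k)"
  proof -
    have "h * k = 1 - s *\<^sub>R k"
      using k(1) by (simp add: h_def distrib_right algebra_simps)
    then show ?thesis
      by (simp add: right_diff_distrib)
  qed
  then have dd: "adj d * d = k - s *\<^sub>R (k * k)"
    by (simp add: d_def adj_mult ka h_def mult.assoc)
  have gg: "s *\<^sub>R (g * g) = s *\<^sub>R (k * k) - k + b *\<^sub>R 1"
    using s unfolding g_def b_def
    by (simp add: left_diff_distrib right_diff_distrib scaleR_diff_right algebra_simps
        flip: scaleR_left_distrib)
  have gpos: "positive_elem (s *\<^sub>R (g * g))"
    using s ga by (simp add: positive_elem_scaleR positive_elem_square)
  have "b *\<^sub>R 1 - adj d * d = s *\<^sub>R (g * g)"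
    by (simp add: dd gg)
  then have "positive_elem (b *\<^sub>R 1 - d * adj d)"
    using gpos b by (intro positive_elem_bound_adj_mult_commute) auto
  moreover have "positive_elem (adj d * d + d * adj d)"
  proof -
    define p where "p = d + adj d"
    define q where "q = \<i> *\<^sub>C (d - adj d)"
    have "adj p = p" "adj q = q"
      by (simp_all add: p_def q_def adj_simps cvs.scale_right_diff_distrib)
    then have "positive_elem ((1/2) *\<^sub>R (p * p + q * q))"
      by (intro positive_elem_scaleR positive_elem_add positive_elem_square) auto
    also have "p * p + q * q = 2 *\<^sub>R (adj d * d + d * adj d)"
      by (simp add: p_def q_def scaleC_ii_mult algebra_simps scaleR_2)
    finally show ?thesis
      by simp
  qed
  ultimately have "positive_elem ((b *\<^sub>R 1 - d * adj d) + (adj d * d + d * adj d))"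
    by (rule positive_elem_add)
  also have "(b *\<^sub>R 1 - d * adj d) + (adj d * d + d * adj d) = (2 * b) *\<^sub>R 1 - s *\<^sub>R (g * g)"
    by (simp add: gg dd scaleR_2 flip: scaleR_scaleR)
  finally have "norm (s *\<^sub>R (g * g)) \<le> 2 * b"
    using gpos by (intro norm_le_if_positive_elem)
  then have "s * (norm g)\<^sup>2 \<le> 2 * b"
    using s ga by (simp add: norm_square_selfadjoint)
  then have "2 * (s * norm g)\<^sup>2 \<le> 1"
    using s by (simp add: b_def field_simps power2_eq_square)
  also have "1 < 2 * (3/4::real)\<^sup>2"
    by (simp add: power2_eq_square)
  finally have "s * norm g \<le> 3/4"
    using power2_less_imp_less[of "s * norm g" "3/4"] by simp
  moreover have "norm k \<le> norm g + 1 / (2 * s)"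
    using norm_triangle_ineq[of g "(1 / (2 * s)) *\<^sub>R 1"] s by (simp add: g_def)
  then have "norm k * s \<le> (norm g + 1 / (2 * s)) * s"
    using s by (intro mult_right_mono) auto
  then have "norm k * s \<le> s * norm g + 1/2"
    using s unfolding distrib_right by (simp add: mult.commute)
  ultimately show ?thesis
    by simp
qed

text \<open>
  By the preceding bound the resolvent at \<open>-s\<close> extends to \<open>-s'\<close> for all \<open>s'\<close> from \<open>s/2\<close> to \<open>s\<close>, so
  starting above the norm and halving, it reaches the whole negative axis.
\<close>

lemma positive_elem_adj_mult_self:
  fixes c :: "'a::unital_cstar_algebra"
  shows "positive_elem (adj c * c)"
proof -
  define h where "h = adj c * c"
  have h: "adj h = h"
    by (simp add: h_def adj_mult adj_adj)
  have inv: "invertible_elem (h + s *\<^sub>R 1)" if "(norm h + 1) / 2 ^ n \<le> s" for s n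
    using that
  proof (induction n arbitrary: s)
    case 0
    have "complex_of_real (- s) \<notin> spectrum h"
    proof
      assume "complex_of_real (- s) \<in> spectrum h"
      then have "\<bar>- s\<bar> \<le> norm h"
        using norm_spectrum_le by (metis norm_of_real real_norm_def)
      then show False
        using 0 by simp
    qed
    then show ?case
      by (simp add: spectrum_def scaleR_eq_scaleC)
  next
    case (Suc n)
    show ?case
    proof (cases "(norm h + 1) / 2 ^ n \<le> s")
      case False
      define u where "u = (norm h + 1) / 2 ^ n"
      have u: "0 < u" "s < u" "u \<le> 2 * s"
        using False Suc.prems by (auto simp: u_def field_simps add_nonneg_pos)
      obtain k where k: "(h + u *\<^sub>R 1) * k = 1" "k * (h + u *\<^sub>R 1) = 1"
        using Suc.IH[of u] by (auto simp: u_def invertible_elem_def)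
      have ku: "norm k * u \<le> 5/4"
        using norm_resolvent_adj_mult_self[of u c k] k u by (simp add: h_def)
      show ?thesis
      proof (rule invertible_elem_perturb[OF k])
        have "(h + u *\<^sub>R 1) - (h + s *\<^sub>R 1) = (u - s) *\<^sub>R 1"
          by (simp add: scaleR_diff_left)
        then have "norm ((h + u *\<^sub>R 1) - (h + s *\<^sub>R 1)) * norm k = (u - s) * norm k"
          using u by simp
        also have "\<dots> \<le> u / 2 * norm k"
          using u by (intro mult_right_mono) auto
        also have "\<dots> < 1"
          using ku by (simp add: mult.commute)
        finally show "norm ((h + u *\<^sub>R 1) - (h + s *\<^sub>R 1)) * norm k < 1" .
      qed
    qed (rule Suc.IH)
  qed
  have "positive_elem h"
  proof (rule positive_elemI_real[OF h])
    fix r assume r: "complex_of_real r \<in> spectrum h"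
    show "0 \<le> r"
    proof (rule ccontr)
      assume "\<not> 0 \<le> r"
      moreover have pos: "norm h + 1 > 0"
        by (simp add: add_nonneg_pos)
      ultimately obtain n where "(1/2) ^ n < - r / (norm h + 1)"
        using real_arch_pow_inv[of "- r / (norm h + 1)" "1/2"] by (auto simp: divide_neg_pos)
      then have "(1/2) ^ n * (norm h + 1) < - r"
        using pos by (simp only: pos_less_divide_eq)
      then have "(norm h + 1) / 2 ^ n \<le> - r"
        by (simp add: power_one_over)
      from inv[OF this] r show False
        by (simp add: spectrum_def scaleR_eq_scaleC)
    qed
  qed
  then show ?thesis
    by (simp add: h_def)
qed

text \<open>
  The Neumann series keeps the spectrum of an invertible \<open>a\<close> at distance at least \<open>1 / \<parallel>a\<^sup>-\<^sup>1\<parallel>\<close> from \<open>0\<close>.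
\<close>

lemma invertible_positive_elem_bound_below:
  fixes a :: "'a::unital_cstar_algebra"
  assumes "positive_elem a" "invertible_elem a"
  obtains e where "e > 0" "positive_elem (a - e *\<^sub>R 1)"
proof -
  obtain k where k: "a * k = 1" "k * a = 1"
    using assms(2) by (auto simp: invertible_elem_def)
  then have "k \<noteq> 0"
    by auto
  define e where "e = 1 / norm k"
  have e: "e > 0"
    using \<open>k \<noteq> 0\<close> by (simp add: e_def)
  have "positive_elem (a - e *\<^sub>R 1)"
  proof (rule positive_elemI_real)
    show "adj (a - e *\<^sub>R 1) = a - e *\<^sub>R 1"
      using assms(1) by (simp add: adj_simps positive_elem_adj)
    fix r assume "complex_of_real r \<in> spectrum (a - e *\<^sub>R 1)"
    then have sp: "complex_of_real (e + r) \<in> spectrum a"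
      using spectrum_translate[of r a "- complex_of_real e"]
      by (simp add: scaleR_eq_scaleC add.commute)
    then have er: "0 \<le> e + r"
      by (rule positive_elem_spectrum_nonneg[OF assms(1)])
    show "0 \<le> r"
    proof (rule ccontr)
      assume "\<not> 0 \<le> r"
      then have "(e + r) * norm k < e * norm k"
        using \<open>k \<noteq> 0\<close> by simp
      then have "(e + r) * norm k < 1"
        using \<open>k \<noteq> 0\<close> by (simp add: e_def)
      moreover have "a - (a - (e + r) *\<^sub>R 1) = (e + r) *\<^sub>R 1"
        by simp
      ultimately have "invertible_elem (a - (e + r) *\<^sub>R 1)"
        using er by (intro invertible_elem_perturb[OF k]) simp
      then show False
        using sp by (simp add: spectrum_def scaleR_eq_scaleC)
    qed
  qed
  then show ?thesis
    using e that by blast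
qed

text \<open>
  After scaling, \<open>a = 1 - w\<close> with \<open>\<parallel>w\<parallel> < 1\<close>, and \<open>a = (1 - z)\<^sup>2\<close> for the fixed point \<open>z\<close> of the
  contraction \<open>z \<mapsto> (w + z\<^sup>2)/2\<close>. Uniqueness of the fixed point makes \<open>z\<close> self-adjoint.
\<close>

lemma invertible_positive_elem_sqrt:
  fixes a :: "'a::unital_cstar_algebra"
  assumes "positive_elem a" "invertible_elem a"
  obtains b where "adj b = b" "a = b * b"
proof -
  obtain e where e: "e > 0" "positive_elem (a - e *\<^sub>R 1)"
    using invertible_positive_elem_bound_below[OF assms] .
  define t where "t = norm (a - e *\<^sub>R 1) + e"
  have t: "t > 0"
    using e by (simp add: t_def add_nonneg_pos)
  define w where "w = 1 - (1 / t) *\<^sub>R a"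
  define \<rho> where "\<rho> = (t - e) / t"
  have \<rho>: "0 \<le> \<rho>" "\<rho> < 1"
    using e t by (simp_all add: \<rho>_def t_def)
  have wa: "adj w = w"
    using assms(1) by (simp add: w_def adj_simps positive_elem_adj)
  have "w = (1 / t) *\<^sub>R ((t - e) *\<^sub>R 1 - (a - e *\<^sub>R 1))"
    using t by (simp add: w_def scaleR_diff_right scaleR_diff_left flip: scaleR_left_distrib)
  also have "norm \<dots> = 1 / t * norm ((t - e) *\<^sub>R 1 - (a - e *\<^sub>R 1))"
    using t by (metis abs_of_pos norm_scaleR zero_less_divide_1_iff)
  also have "\<dots> \<le> 1 / t * (t - e)"
    using t e(2) by (intro mult_left_mono positive_elem_norm_reflect) (auto simp: t_def)
  finally have w: "norm w \<le> \<rho>"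
    by (simp add: \<rho>_def)
  define f where "f z = (1/2) *\<^sub>R (w + z * z)" for z
  have ex1: "\<exists>!z. z \<in> cball 0 \<rho> \<and> f z = z"
  proof (rule Banach_fix[where c = \<rho>])
    show "f ` cball 0 \<rho> \<subseteq> cball 0 \<rho>"
    proof clarify
      fix z :: 'a assume z: "z \<in> cball 0 \<rho>"
      have "norm (z * z) \<le> norm z * norm z"
        by (rule norm_mult_ineq)
      also have "\<dots> \<le> 1 * \<rho>"
        using z \<rho> by (intro mult_mono) auto
      finally show "f z \<in> cball 0 \<rho>"
        using w norm_triangle_ineq[of w "z * z"] by (simp add: f_def)
    qed
    show "dist (f y) (f z) \<le> \<rho> * dist y z" if "y \<in> cball 0 \<rho>" "z \<in> cball 0 \<rho>" for y z
    proof -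
      have "f y - f z = (1/2) *\<^sub>R (y * (y - z) + (y - z) * z)"
        by (simp add: f_def right_diff_distrib left_diff_distrib flip: scaleR_diff_right)
      also have "norm \<dots> \<le> 1/2 * (norm y * norm (y - z) + norm (y - z) * norm z)"
        by (simp add: norm_triangle_mono norm_mult_ineq)
      also have "\<dots> \<le> 1/2 * (\<rho> * norm (y - z) + norm (y - z) * \<rho>)"
        using that by (intro mult_left_mono add_mono mult_right_mono) auto
      finally show ?thesis
        by (simp add: dist_norm mult.commute)
    qed
  qed (use \<rho> in \<open>auto simp: complete_eq_closed\<close>)
  then obtain z where z: "z \<in> cball 0 \<rho>" "f z = z"
    by (elim ex1E conjE)
  have "f (adj z) = adj z"
    using arg_cong[OF z(2), of adj] by (simp add: f_def adj_simps wa)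
  moreover have "adj z \<in> cball 0 \<rho>"
    using z(1) by (simp add: norm_adj)
  ultimately have za: "adj z = z"
    using ex1 z by blast
  have "2 *\<^sub>R z = w + z * z"
    using arg_cong[OF z(2), of "\<lambda>x. 2 *\<^sub>R x"] by (simp add: f_def)
  then have w_eq: "w = 2 *\<^sub>R z - z * z"
    by simp
  have "(1 - z) * (1 - z) = 1 - w"
    unfolding w_eq by (simp add: left_diff_distrib right_diff_distrib scaleR_2)
  also have "\<dots> = (1 / t) *\<^sub>R a"
    by (simp add: w_def)
  finally have sq: "(1 - z) * (1 - z) = (1 / t) *\<^sub>R a" .
  show ?thesis
  proof (rule that)
    show "adj (sqrt t *\<^sub>R (1 - z)) = sqrt t *\<^sub>R (1 - z)"
      by (simp add: adj_simps za)
    show "a = (sqrt t *\<^sub>R (1 - z)) * (sqrt t *\<^sub>R (1 - z))"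
      using t by (simp add: sq)
  qed
qed

lemma positive_elem_sandwich:
  fixes a x :: "'a::unital_cstar_algebra"
  assumes "positive_elem a" "invertible_elem a"
  shows "positive_elem (adj x * a * x)"
proof -
  obtain b where b: "adj b = b" "a = b * b"
    using invertible_positive_elem_sqrt[OF assms] .
  then have "adj x * a * x = adj (b * x) * (b * x)"
    by (simp add: adj_mult mult.assoc)
  then show ?thesis
    by (simp add: positive_elem_adj_mult_self)
qed

section \<open>Positive functionals\<close>

lemma vector_space_complex_mult: "vector_space ((*) :: complex \<Rightarrow> complex \<Rightarrow> complex)"
  by unfold_locales (simp_all add: algebra_simps)

lemma clinear_iff:
  fixes \<phi> :: "'a::unital_cstar_algebra \<Rightarrow> complex"
  shows "Vector_Spaces.linear scaleC (*) \<phi> \<longleftrightarrow>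
    (\<forall>x y. \<phi> (x + y) = \<phi> x + \<phi> y) \<and> (\<forall>c x. \<phi> (c *\<^sub>C x) = c * \<phi> x)"
  by (simp add: Vector_Spaces.linear_iff vector_space_complex_mult cvs.vector_space_axioms)

text \<open>
  Linear functionals that are nonnegative on positive elements. Continuity is not required, since it
  is automatic (\<open>topological_dual_if_positive\<close>).
\<close>

locale positive_linear =
  fixes \<phi> :: "'a::unital_cstar_algebra \<Rightarrow> complex"
  assumes add: "\<phi> (x + y) = \<phi> x + \<phi> y"
    and scaleC: "\<phi> (c *\<^sub>C x) = c * \<phi> x"
    and positive: "positive_elem x \<Longrightarrow> \<phi> x \<in> complex_of_real ` {0..}"
begin

lemma scaleR: "\<phi> (r *\<^sub>R x) = complex_of_real r * \<phi> x"
  by (simp add: scaleR_eq_scaleC scaleC)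

lemma diff: "\<phi> (x - y) = \<phi> x - \<phi> y"
  using add[of "x - y" y] by simp

lemma minus: "\<phi> (- x) = - \<phi> x"
  using scaleC[of "-1" x] by simp

lemma positive_Re: "positive_elem x \<Longrightarrow> 0 \<le> Re (\<phi> x)"
  and positive_Im: "positive_elem x \<Longrightarrow> Im (\<phi> x) = 0"
  using positive[of x] by auto

lemma Im_one: "Im (\<phi> 1) = 0"
  using positive_Im[OF positive_elem_square[of 1]] by (simp add: adj_one)

lemma Im_selfadjoint:
  assumes "adj h = h"
  shows "Im (\<phi> h) = 0"
  using positive_Im[OF positive_elem_norm_plus[OF assms]] Im_one by (simp add: add scaleR)

lemma norm_selfadjoint_le:
  assumes "adj h = h"
  shows "cmod (\<phi> h) \<le> norm h * Re (\<phi> 1)"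
proof -
  have "0 \<le> Re (\<phi> (norm h *\<^sub>R 1 + h))"
    by (intro positive_Re positive_elem_norm_plus assms)
  moreover have "0 \<le> Re (\<phi> (norm (- h) *\<^sub>R 1 + (- h)))"
    by (intro positive_Re positive_elem_norm_plus) (simp add: adj_minus assms)
  ultimately have "\<bar>Re (\<phi> h)\<bar> \<le> norm h * Re (\<phi> 1)"
    by (simp add: add scaleR minus diff)
  then show ?thesis
    using Im_selfadjoint[OF assms] by (simp add: cmod_eq_Re)
qed

lemma Re_one: "0 \<le> Re (\<phi> 1)"
  using norm_selfadjoint_le[of 1] norm_ge_zero[of "\<phi> 1"] by (simp add: adj_one del: norm_ge_zero)

lemma real_imaginary_parts:
  fixes x :: 'a
  obtains p q where "adj p = p" "adj q = q" "x = p + \<i> *\<^sub>C q" "norm p \<le> norm x" "norm q \<le> norm x"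
proof
  define p where "p = (1/2) *\<^sub>C (x + adj x)"
  define q where "q = (- \<i> / 2) *\<^sub>C (x - adj x)"
  show "adj p = p" "adj q = q"
    by (simp_all add: p_def q_def adj_simps cvs.scale_right_distrib cvs.scale_right_diff_distrib)
  show "x = p + \<i> *\<^sub>C q"
    by (simp add: p_def q_def cvs.scale_right_distrib cvs.scale_right_diff_distrib
        flip: cvs.scale_left_distrib)
  show "norm p \<le> norm x" "norm q \<le> norm x"
    using norm_triangle_ineq[of x "adj x"] norm_triangle_ineq4[of x "adj x"]
    by (simp_all add: p_def q_def norm_scaleC norm_adj norm_divide)
qed

lemma adj: "\<phi> (adj x) = cnj (\<phi> x)"
proof -
  obtain p q where pq: "adj p = p" "adj q = q" "x = p + \<i> *\<^sub>C q"
    using real_imaginary_parts .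
  then have "\<phi> (adj x) = \<phi> p - \<i> * \<phi> q" "\<phi> x = \<phi> p + \<i> * \<phi> q"
    by (simp_all add: adj_simps diff add scaleC)
  then show ?thesis
    using Im_selfadjoint[of p] Im_selfadjoint[of q] pq by (simp add: complex_eq_iff)
qed

lemma norm_le: "cmod (\<phi> x) \<le> 2 * Re (\<phi> 1) * norm x"
proof -
  obtain p q where pq: "adj p = p" "adj q = q" "x = p + \<i> *\<^sub>C q" "norm p \<le> norm x" "norm q \<le> norm x"
    using real_imaginary_parts .
  have "cmod (\<phi> x) \<le> cmod (\<phi> p) + cmod (\<phi> q)"
    using norm_triangle_ineq[of "\<phi> p" "\<i> * \<phi> q"] pq(3) by (simp add: add scaleC norm_mult)
  also have "\<dots> \<le> norm x * Re (\<phi> 1) + norm x * Re (\<phi> 1)"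
    using pq norm_selfadjoint_le Re_one by (meson add_mono mult_right_mono order_trans)
  finally show ?thesis
    by (simp add: mult_ac)
qed

lemma topological_dual_if_positive: "\<phi> \<in> topological_dual"
proof -
  have "bounded_linear \<phi>"
  proof (rule bounded_linear_intro)
    show "norm (\<phi> x) \<le> norm x * (2 * Re (\<phi> 1))" for x
      using norm_le[of x] by (simp add: mult_ac)
    show "\<phi> (r *\<^sub>R x) = r *\<^sub>R \<phi> x" for r x
      by (simp add: scaleR scaleR_conv_of_real[of r "\<phi> x"])
  qed (rule add)
  then have "continuous_on UNIV \<phi>"
    by (simp add: linear_continuous_on)
  then show ?thesis
    by (simp add: topological_dual_def clinear_iff add scaleC)
qed

end

lemma mem_a_states_iff: "\<phi> \<in> a_states a \<longleftrightarrow> positive_linear \<phi> \<and> \<phi> a = 1"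
  using positive_linear.topological_dual_if_positive[of \<phi>]
  by (auto simp: a_states_def positive_functional_def topological_dual_def clinear_iff
      positive_linear_def)

lemma a_states_uniformly_bounded:
  fixes a :: "'a::unital_cstar_algebra"
  assumes "positive_elem a" "invertible_elem a"
  shows "\<exists>K\<ge>0. \<forall>\<phi>\<in>a_states a. \<forall>x. cmod (\<phi> x) \<le> K * norm x"
proof -
  obtain e where e: "e > 0" "positive_elem (a - e *\<^sub>R 1)"
    using invertible_positive_elem_bound_below[OF assms] .
  have "cmod (\<phi> x) \<le> 2 / e * norm x" if "\<phi> \<in> a_states a" for \<phi> x
  proof -
    interpret positive_linear \<phi>
      using that by (simp add: mem_a_states_iff)
    have "e * Re (\<phi> 1) \<le> 1"
      using positive_Re[OF e(2)] that by (simp add: diff scaleR mem_a_states_iff)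
    then have "2 * Re (\<phi> 1) * norm x \<le> 2 / e * norm x"
      using e(1) by (intro mult_right_mono) (simp_all add: pos_le_divide_eq mult.commute)
    then show ?thesis
      using norm_le[of x] by linarith
  qed
  then show ?thesis
    using e(1) by (intro exI[of _ "2 / e"]) simp
qed

text \<open>
  The states form a closed subset of a product of discs in the topology of pointwise convergence,
  the product topology on the function type; the product is compact by Tychonoff's theorem.
\<close>

lemma compact_a_states:
  fixes a :: "'a::unital_cstar_algebra"
  assumes "positive_elem a" "invertible_elem a"
  shows "compact (a_states a)"
proof -
  obtain K where K: "\<forall>\<phi>\<in>a_states a. \<forall>x. cmod (\<phi> x) \<le> K * norm x"
    using a_states_uniformly_bounded[OF assms] by auto
  define B where "B = PiE UNIV (\<lambda>x::'a. cball (0::complex) (K * norm x))"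
  have "compactin (product_topology (\<lambda>x::'a. euclidean) UNIV) B"
    unfolding B_def by (simp add: compactin_PiE)
  then have B: "compact B"
    by (simp add: euclidean_product_topology)
  define N where "N = complex_of_real ` {0..}"
  have N: "closed N"
  proof -
    have "z \<in> N" if "Im z = 0" "0 \<le> Re z" for z
      unfolding N_def by (rule image_eqI[of _ _ "Re z"]) (use that in \<open>auto simp: complex_eq_iff\<close>)
    then have "N = {z. Im z = 0} \<inter> {z. 0 \<le> Re z}"
      by (auto simp: N_def)
    then show ?thesis
      by (simp only:) (intro closed_Int closed_Collect_eq closed_Collect_le continuous_intros)
  qed
  have eval: "continuous_on UNIV (\<lambda>\<phi>::'a \<Rightarrow> complex. \<phi> x)" for x
    by (rule continuous_on_product_coordinates)
  define L where "L = (\<Inter>x y. {\<phi>::'a \<Rightarrow> complex. \<phi> (x + y) = \<phi> x + \<phi> y})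
      \<inter> (\<Inter>c x. {\<phi>. \<phi> (c *\<^sub>C x) = c * \<phi> x})
      \<inter> (\<Inter>x\<in>Collect positive_elem. (\<lambda>\<phi>. \<phi> x) -` N) \<inter> {\<phi>. \<phi> a = 1}"
  have "closed {\<phi>::'a \<Rightarrow> complex. \<phi> (x + y) = \<phi> x + \<phi> y}" for x y
    by (intro closed_Collect_eq continuous_on_add eval)
  moreover have "closed {\<phi>::'a \<Rightarrow> complex. \<phi> (c *\<^sub>C x) = c * \<phi> x}" for c x
    by (intro closed_Collect_eq continuous_on_mult continuous_on_const eval)
  moreover have "closed ((\<lambda>\<phi>::'a \<Rightarrow> complex. \<phi> x) -` N)" for x
    by (intro closed_vimage N eval)
  moreover have "closed {\<phi>::'a \<Rightarrow> complex. \<phi> a = 1}"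
    by (intro closed_Collect_eq continuous_on_const eval)
  ultimately have "closed L"
    unfolding L_def by (intro closed_Int closed_INT ballI) auto
  moreover have "a_states a = B \<inter> L"
  proof -
    have "\<phi> \<in> L \<longleftrightarrow> \<phi> \<in> a_states a" for \<phi>
      unfolding mem_a_states_iff positive_linear_def L_def N_def by blast
    moreover have "\<phi> \<in> B" if "\<phi> \<in> a_states a" for \<phi>
      using K that by (simp add: B_def PiE_iff)
    ultimately show ?thesis
      by blast
  qed
  ultimately show ?thesis
    using B by (simp add: compact_Int_closed)
qed

section \<open>Existence of states\<close>

text \<open>
  Positive homogeneity is required only as an inequality, which suffices (\<open>sublinearD\<close>).
\<close>

definition sublinear :: "('a::real_vector \<Rightarrow> real) \<Rightarrow> bool" where
  "sublinear q \<longleftrightarrow> (\<forall>x y. q (x + y) \<le> q x + q y) \<and> (\<forall>r\<ge>0. \<forall>x. q (r *\<^sub>R x) \<le> r * q x)"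

lemma sublinearD:
  assumes "sublinear q"
  shows "q (x + y) \<le> q x + q y" "0 \<le> r \<Longrightarrow> q (r *\<^sub>R x) = r * q x" "q 0 = 0" "- q (- x) \<le> q x"
proof -
  show sub: "q (x + y) \<le> q x + q y" for x y
    using assms by (simp add: sublinear_def)
  have hom: "q (r *\<^sub>R x) \<le> r * q x" if "0 \<le> r" for r x
    using assms that by (simp add: sublinear_def)
  show zero: "q 0 = 0"
    using sub[of 0 0] hom[of 0 0] by simp
  show "q (r *\<^sub>R x) = r * q x" if "0 \<le> r"
  proof (cases "r = 0")
    case False
    then have "q x \<le> (1 / r) * q (r *\<^sub>R x)"
      using hom[of "1 / r" "r *\<^sub>R x"] that by simp
    then show ?thesis
      using hom[OF that, of x] that False by (simp add: field_simps)
  qed (simp add: zero)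
  show "- q (- x) \<le> q x"
    using sub[of x "- x"] zero by simp
qed

text \<open>
  For sublinear \<open>q\<close>, the largest sublinear minorant that takes the value \<open>- q y\<close> at \<open>-y\<close>; this makes
  it additive in the direction \<open>y\<close>.
\<close>

definition flatten :: "'a::real_vector \<Rightarrow> ('a \<Rightarrow> real) \<Rightarrow> 'a \<Rightarrow> real" where
  "flatten y q x = (INF t\<in>{0..}. q (x + t *\<^sub>R y) - t * q y)"

lemma
  assumes q: "sublinear q"
  shows sublinear_flatten: "sublinear (flatten y q)"
    and flatten_le: "flatten y q x \<le> q x"
    and flatten_uminus: "flatten y q (- y) \<le> - q y"
proof -
  have "- q (- x) \<le> q (x + t *\<^sub>R y) - t * q y" if "0 \<le> t" for t x
    using sublinearD(1)[OF q, of "x + t *\<^sub>R y" "- x"] sublinearD(2)[OF q that, of y] by simp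
  then have bdd: "bdd_below ((\<lambda>t. q (x + t *\<^sub>R y) - t * q y) ` {0..})" for x
    by (intro bdd_belowI2) auto
  have lower: "flatten y q x \<le> q (x + t *\<^sub>R y) - t * q y" if "0 \<le> t" for t x
    unfolding flatten_def by (rule cINF_lower[OF bdd]) (use that in simp)
  have greatest: "m \<le> flatten y q x" if "\<And>t. 0 \<le> t \<Longrightarrow> m \<le> q (x + t *\<^sub>R y) - t * q y" for m x
    unfolding flatten_def by (rule cINF_greatest) (use that in auto)
  show "flatten y q x \<le> q x"
    using lower[of 0 x] by simp
  show "flatten y q (- y) \<le> - q y"
    using lower[of 1 "- y"] sublinearD(3)[OF q] by simp
  show "sublinear (flatten y q)"
    unfolding sublinear_def
  proof (intro conjI allI impI)
    fix x z
    have "flatten y q (x + z) - flatten y q z \<le> q (x + s *\<^sub>R y) - s * q y" if s: "0 \<le> s" for s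
    proof -
      have "flatten y q (x + z) - (q (x + s *\<^sub>R y) - s * q y) \<le> q (z + t *\<^sub>R y) - t * q y"
        if t: "0 \<le> t" for t
      proof -
        have "flatten y q (x + z) \<le> q ((x + z) + (s + t) *\<^sub>R y) - (s + t) * q y"
          using s t by (intro lower) simp
        also have "(x + z) + (s + t) *\<^sub>R y = (x + s *\<^sub>R y) + (z + t *\<^sub>R y)"
          by (simp add: algebra_simps)
        also have "q \<dots> \<le> q (x + s *\<^sub>R y) + q (z + t *\<^sub>R y)"
          by (rule sublinearD(1)[OF q])
        finally show ?thesis
          by (simp add: algebra_simps)
      qed
      from greatest[OF this] show ?thesis
        by simp
    qed
    from greatest[OF this] show "flatten y q (x + z) \<le> flatten y q x + flatten y q z"
      by simp
  next
    fix r :: real and x assume r: "0 \<le> r"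
    have le: "flatten y q (r *\<^sub>R x) \<le> r * (q (x + t *\<^sub>R y) - t * q y)" if t: "0 \<le> t" for t
    proof -
      have "flatten y q (r *\<^sub>R x) \<le> q (r *\<^sub>R x + (r * t) *\<^sub>R y) - (r * t) * q y"
        using r t by (intro lower) simp
      also have "r *\<^sub>R x + (r * t) *\<^sub>R y = r *\<^sub>R (x + t *\<^sub>R y)"
        by (simp add: scaleR_add_right)
      finally show ?thesis
        by (simp add: sublinearD(2)[OF q r] right_diff_distrib mult.assoc)
    qed
    show "flatten y q (r *\<^sub>R x) \<le> r * flatten y q x"
    proof (cases "r = 0")
      case False
      then have "flatten y q (r *\<^sub>R x) / r \<le> flatten y q x"
        using le r by (intro greatest) (simp add: field_simps)
      then show ?thesis
        using False r by (simp add: field_simps)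
    qed (use le[of 0] in simp)
  qed
qed

lemma minimal_sublinear_exists:
  fixes p :: "'a::real_vector \<Rightarrow> real"
  assumes p: "sublinear p"
  shows "\<exists>q. sublinear q \<and> q \<le> p \<and> (\<forall>q'. sublinear q' \<and> q' \<le> q \<longrightarrow> q' = q)"
proof -
  define A where "A = {q. sublinear q \<and> q \<le> p}"
  have "\<exists>m\<in>A. \<forall>q\<in>A. q \<le> m \<longrightarrow> q = m"
  proof (rule predicate_Zorn)
    show "partial_order_on A (relation_of (\<lambda>f g. g \<le> f) A)"
      by (rule partial_order_on_relation_ofI) auto
    fix C assume C: "C \<in> Chains (relation_of (\<lambda>f g. g \<le> f) A)"
    then have CA: "C \<subseteq> A" and chain: "\<And>f g. f \<in> C \<Longrightarrow> g \<in> C \<Longrightarrow> f \<le> g \<or> g \<le> f"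
      by (auto simp: Chains_def relation_of_def)
    show "\<exists>u\<in>A. \<forall>f\<in>C. u \<le> f"
    proof (cases "C = {}")
      case True
      then show ?thesis
        using p by (auto simp: A_def)
    next
      case False
      define u where "u x = (INF f\<in>C. f x)" for x
      have "- p (- x) \<le> f x" if "f \<in> C" for f x
      proof -
        have "sublinear f" "f (- x) \<le> p (- x)"
          using that CA by (auto simp: A_def le_fun_def)
        then show ?thesis
          using sublinearD(4)[of f x] by simp
      qed
      then have bdd: "bdd_below ((\<lambda>f. f x) ` C)" for x
        by (intro bdd_belowI2) auto
      have lower: "u x \<le> f x" if "f \<in> C" for f x
        unfolding u_def by (rule cINF_lower[OF bdd that])
      have greatest: "m \<le> u x" if "\<And>f. f \<in> C \<Longrightarrow> m \<le> f x" for m x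
        unfolding u_def by (rule cINF_greatest) (use False that in auto)
      have sl: "sublinear f" if "f \<in> C" for f
        using that CA by (auto simp: A_def)
      have "sublinear u"
        unfolding sublinear_def
      proof (intro conjI allI impI)
        fix x y
        have "u (x + y) - u y \<le> f x" if f: "f \<in> C" for f
        proof -
          have "u (x + y) - f x \<le> g y" if g: "g \<in> C" for g
          proof -
            obtain h where "h \<in> C" "h \<le> f" "h \<le> g"
              using chain[OF f g] f g by blast
            then show ?thesis
              using lower[of h "x + y"] sublinearD(1)[OF sl[of h], of x y]
                le_funD[of h f x] le_funD[of h g y] by linarith
          qed
          then show ?thesis
            using greatest[of "u (x + y) - f x" y] by simp
        qed
        then show "u (x + y) \<le> u x + u y"
          using greatest[of "u (x + y) - u y" x] by simp
      next
        fix r :: real and x assume r: "0 \<le> r"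
        have le: "u (r *\<^sub>R x) \<le> r * f x" if "f \<in> C" for f
          using lower[OF that, of "r *\<^sub>R x"] sublinearD(2)[OF sl[OF that] r, of x] by simp
        show "u (r *\<^sub>R x) \<le> r * u x"
        proof (cases "r = 0")
          case True
          then show ?thesis
            using le False by fastforce
        next
          case False
          then have "u (r *\<^sub>R x) / r \<le> u x"
            using le r by (intro greatest) (simp add: field_simps)
          then show ?thesis
            using False r by (simp add: field_simps)
        qed
      qed
      moreover have "u \<le> p"
      proof -
        obtain f where f: "f \<in> C"
          using False by blast
        then have "f \<le> p"
          using CA by (auto simp: A_def)
        then show ?thesis
          using lower[OF f] by (meson le_funD le_funI order_trans)
      qed
      ultimately have "u \<in> A"
        by (simp add: A_def)
      moreover have "u \<le> f" if "f \<in> C" for f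
        using lower[OF that] by (rule le_funI)
      ultimately show ?thesis
        by blast
    qed
  qed
  then obtain m where m: "sublinear m" "m \<le> p" and min: "\<forall>q\<in>A. q \<le> m \<longrightarrow> q = m"
    by (auto simp: A_def)
  have "q = m" if "sublinear q" "q \<le> m" for q
    using min that order_trans[OF that(2) m(2)] by (simp add: A_def)
  with m show ?thesis
    by blast
qed

text \<open>
  The Hahn-Banach theorem: a minimal sublinear functional \<open>q\<close> equals each of its flattenings, so
  \<open>q (- y) \<le> - q y\<close> for all \<open>y\<close>, which makes it linear.
\<close>

lemma hahn_banach_supporting_functional:
  fixes p :: "'a::real_vector \<Rightarrow> real"
  assumes p: "sublinear p"
  shows "\<exists>f. linear f \<and> (\<forall>x. f x \<le> p x) \<and> f y = p y"
proof -
  obtain q where q: "sublinear q" "q \<le> flatten y p"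
      and min: "\<forall>q'. sublinear q' \<and> q' \<le> q \<longrightarrow> q' = q"
    using minimal_sublinear_exists[OF sublinear_flatten[OF p, of y]] by blast
  have flat: "flatten z q = q" for z
    using q(1) by (intro min[rule_format] conjI sublinear_flatten le_funI flatten_le)
  have minus: "q (- z) = - q z" for z
    using flatten_uminus[OF q(1), of z] sublinearD(4)[OF q(1), of z] by (simp add: flat)
  have "linear q"
  proof (rule linearI)
    fix x z
    show "q (x + z) = q x + q z"
      using sublinearD(1)[OF q(1), of x z] sublinearD(1)[OF q(1), of "x + z" "- z"] minus[of z]
      by simp
    fix r
    show "q (r *\<^sub>R x) = r *\<^sub>R q x"
      using sublinearD(2)[OF q(1), of r x] sublinearD(2)[OF q(1), of "- r" x] minus[of "r *\<^sub>R x"]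
      by (cases "0 \<le> r") auto
  qed
  moreover have le: "q x \<le> flatten y p x" for x
    using q(2) by (simp add: le_fun_def)
  have "q x \<le> p x" for x
    using le flatten_le[OF p] by (rule order_trans)
  moreover have "q y = p y"
    using le[of "- y"] flatten_uminus[OF p, of y] minus[of y] \<open>\<And>x. q x \<le> p x\<close>[of y] by simp
  ultimately show ?thesis
    by blast
qed

text \<open>
  Extend \<open>1 \<mapsto> 1\<close> to a real-linear functional \<open>f\<close> dominated by the norm of the real part. It vanishes
  on \<open>i h\<close> for self-adjoint \<open>h\<close>, and \<open>f h \<ge> 0\<close> for positive \<open>h\<close> because
  \<open>\<parallel>h\<parallel> - f h \<le> \<parallel> \<parallel>h\<parallel> 1 - h \<parallel> \<le> \<parallel>h\<parallel>\<close>. So its complexification is positive. It does not vanish at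
  \<open>a\<close>, which dominates a positive multiple of \<open>1\<close>, and can be normalised there.
\<close>

lemma a_states_nonempty:
  fixes a :: "'a::unital_cstar_algebra"
  assumes "positive_elem a" "invertible_elem a"
  shows "a_states a \<noteq> {}"
proof -
  define p where "p x = norm ((1/2) *\<^sub>R (x + adj x))" for x :: 'a
  have "sublinear p"
    unfolding sublinear_def
  proof (intro conjI allI impI)
    fix x y :: 'a
    have "(1/2) *\<^sub>R (x + y + adj (x + y)) = (1/2) *\<^sub>R (x + adj x) + (1/2) *\<^sub>R (y + adj y)"
      by (simp add: adj_add algebra_simps)
    then show "p (x + y) \<le> p x + p y"
      unfolding p_def by (metis norm_triangle_ineq)
    fix r :: real assume "0 \<le> r"
    then show "p (r *\<^sub>R x) \<le> r * p x"
      by (simp add: p_def adj_scaleR flip: scaleR_add_right)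
  qed
  then obtain f where lin: "linear f" and le: "\<And>x. f x \<le> p x" and "f 1 = p 1"
    using hahn_banach_supporting_functional[of p 1] by blast
  have p_sa: "p h = norm h" if "adj h = h" for h
    using that by (simp add: p_def flip: scaleR_2)
  have f1: "f 1 = 1"
    using \<open>f 1 = p 1\<close> p_sa[of 1] by (simp add: adj_one)
  have f_pos: "0 \<le> f h" if "positive_elem h" for h
  proof -
    have "f (norm h *\<^sub>R 1 - h) \<le> norm (norm h *\<^sub>R 1 - h)"
      using le[of "norm h *\<^sub>R 1 - h"] p_sa[of "norm h *\<^sub>R 1 - h"] that
      by (simp add: adj_simps positive_elem_adj)
    also have "\<dots> \<le> norm h"
      using that by (simp add: positive_elem_norm_reflect)
    finally show ?thesis
      using f1 by (simp add: linear_diff[OF lin] linear_scale[OF lin])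
  qed
  have f_ii: "f (\<i> *\<^sub>C h) = 0" if "adj h = h" for h
    using le[of "\<i> *\<^sub>C h"] le[of "- (\<i> *\<^sub>C h)"] that
    by (simp add: p_def adj_simps linear_neg[OF lin])
  define F where "F x = Complex (f x) (- f (\<i> *\<^sub>C x))" for x
  interpret F: positive_linear F
  proof
    show "F (x + y) = F x + F y" for x y
      by (simp add: F_def cvs.scale_right_distrib linear_add[OF lin] complex_eq_iff)
    show "F (c *\<^sub>C x) = c * F x" for c x
    proof -
      have c: "c *\<^sub>C x = Re c *\<^sub>R x + Im c *\<^sub>R (\<i> *\<^sub>C x)"
        unfolding scaleR_eq_scaleC
        by (subst complex_eq[of c]) (simp add: cvs.scale_left_distrib mult.commute)
      have ic: "\<i> *\<^sub>C c *\<^sub>C x = Re c *\<^sub>R (\<i> *\<^sub>C x) - Im c *\<^sub>R x"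
        unfolding c by (simp add: scaleR_eq_scaleC cvs.scale_right_distrib mult.commute)
      show ?thesis
        unfolding F_def ic unfolding c
        by (simp add: linear_add[OF lin] linear_diff[OF lin] linear_scale[OF lin] complex_eq_iff)
    qed
    show "F h \<in> complex_of_real ` {0..}" if "positive_elem h" for h
      using f_pos[OF that] f_ii[OF positive_elem_adj[OF that]]
      by (auto simp: F_def image_iff complex_eq_iff)
  qed
  obtain e where e: "e > 0" "positive_elem (a - e *\<^sub>R 1)"
    using invertible_positive_elem_bound_below[OF assms] .
  have "Re (F a) > 0"
    using F.positive_Re[OF e(2)] e(1) f1 by (simp add: F.diff F.scaleR) (simp add: F_def)
  then obtain r where r: "F a = complex_of_real r" "r > 0"
    using F.positive[OF assms(1)] by auto
  define \<phi> where "\<phi> x = F x / complex_of_real r" for x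
  have "positive_linear \<phi>"
  proof
    show "\<phi> h \<in> complex_of_real ` {0..}" if "positive_elem h" for h
    proof -
      obtain s where "F h = complex_of_real s" "0 \<le> s"
        using F.positive[OF \<open>positive_elem h\<close>] by auto
      then show ?thesis
        using r(2) by (auto simp: \<phi>_def simp flip: of_real_divide)
    qed
  qed (simp_all add: \<phi>_def F.add F.scaleC add_divide_distrib)
  moreover have "\<phi> a = 1"
    using r by (simp add: \<phi>_def)
  ultimately show ?thesis
    using mem_a_states_iff by blast
qed

section \<open>The orthogonality criterion\<close>

text \<open>
  For a state \<open>\<phi>\<close>, the expression under the square root in the norm of \<open>x\<close>, and the sesquilinear
  form that polarises it, conjugate-linear in \<open>x\<close>. The real part makes the first one real-valued and
  loses nothing, because for positive \<open>a\<close> the element \<open>x\<^sup>* a x\<close> is self-adjoint and \<open>\<phi>\<close> is real there.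
\<close>

definition al_quad :: "'a::unital_cstar_algebra \<Rightarrow> real \<Rightarrow> ('a \<Rightarrow> complex) \<Rightarrow> 'a \<Rightarrow> real" where
  "al_quad a l \<phi> x = l * Re (\<phi> (adj x * a * x)) + (1 - l) * (cmod (\<phi> (a * x)))\<^sup>2"

definition al_pair :: "'a::unital_cstar_algebra \<Rightarrow> real \<Rightarrow> ('a \<Rightarrow> complex) \<Rightarrow> 'a \<Rightarrow> 'a \<Rightarrow> complex" where
  "al_pair a l \<phi> x y = complex_of_real l * \<phi> (adj x * a * y)
     + complex_of_real (1 - l) * cnj (\<phi> (a * x)) * \<phi> (a * y)"

lemma al_quad_add:
  fixes a x y :: "'a::unital_cstar_algebra"
  assumes "adj a = a" "\<phi> \<in> a_states a"
  shows "al_quad a l \<phi> (x + \<xi> *\<^sub>C y)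
    = al_quad a l \<phi> x + 2 * Re (\<xi> * al_pair a l \<phi> x y) + (cmod \<xi>)\<^sup>2 * al_quad a l \<phi> y"
proof -
  interpret positive_linear \<phi>
    using assms(2) by (simp add: mem_a_states_iff)
  have "adj y * a * x = adj (adj x * a * y)"
    by (simp add: adj_mult adj_adj assms(1) mult.assoc)
  then have herm: "\<phi> (adj y * a * x) = cnj (\<phi> (adj x * a * y))"
    by (simp only: adj)
  have expand: "adj (x + \<xi> *\<^sub>C y) * a * (x + \<xi> *\<^sub>C y) = adj x * a * x + \<xi> *\<^sub>C (adj x * a * y)
      + cnj \<xi> *\<^sub>C (adj y * a * x) + (cnj \<xi> * \<xi>) *\<^sub>C (adj y * a * y)"
    by (simp add: adj_add adj_scaleC distrib_left distrib_right mult_scaleC_left mult_scaleC_right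
        mult.commute cvs.scale_right_distrib add_ac)
  have 1: "Re (\<phi> (adj (x + \<xi> *\<^sub>C y) * a * (x + \<xi> *\<^sub>C y))) = Re (\<phi> (adj x * a * x))
      + 2 * Re (\<xi> * \<phi> (adj x * a * y)) + (cmod \<xi>)\<^sup>2 * Re (\<phi> (adj y * a * y))"
    unfolding expand add scaleC herm cmod_power2 by (simp add: power2_eq_square algebra_simps)
  have "\<phi> (a * (x + \<xi> *\<^sub>C y)) = \<phi> (a * x) + \<xi> * \<phi> (a * y)"
    by (simp add: distrib_left mult_scaleC_right add scaleC)
  then have 2: "(cmod (\<phi> (a * (x + \<xi> *\<^sub>C y))))\<^sup>2 = (cmod (\<phi> (a * x)))\<^sup>2
      + 2 * Re (\<xi> * (cnj (\<phi> (a * x)) * \<phi> (a * y))) + (cmod \<xi>)\<^sup>2 * (cmod (\<phi> (a * y)))\<^sup>2"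
    unfolding cmod_power2 by (simp add: power2_eq_square algebra_simps)
  have 3: "Re (\<xi> * al_pair a l \<phi> x y) = l * Re (\<xi> * \<phi> (adj x * a * y))
      + (1 - l) * Re (\<xi> * (cnj (\<phi> (a * x)) * \<phi> (a * y)))"
  proof -
    have "\<xi> * al_pair a l \<phi> x y = complex_of_real l * (\<xi> * \<phi> (adj x * a * y))
      + complex_of_real (1 - l) * (\<xi> * (cnj (\<phi> (a * x)) * \<phi> (a * y)))"
      by (simp add: al_pair_def algebra_simps)
    then show ?thesis
      by (simp only: plus_complex.simps Re_complex_of_real Im_complex_of_real times_complex.simps)
  qed
  show ?thesis
    unfolding al_quad_def 1 2 3 by (simp add: algebra_simps)
qed

context
  fixes a :: "'a::unital_cstar_algebra" and l :: real
  assumes a: "positive_elem a" "invertible_elem a" and l: "l \<in> {0..1}"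
begin

lemma al_quad_nonneg:
  assumes "\<phi> \<in> a_states a"
  shows "0 \<le> al_quad a l \<phi> x"
proof -
  interpret positive_linear \<phi>
    using assms by (simp add: mem_a_states_iff)
  have "0 \<le> Re (\<phi> (adj x * a * x))"
    by (intro positive_Re positive_elem_sandwich a)
  then show ?thesis
    using l by (simp add: al_quad_def)
qed

lemma al_pair_bounded: "\<exists>C. \<forall>\<phi>\<in>a_states a. cmod (al_pair a l \<phi> x y) \<le> C"
proof -
  obtain K where K: "\<forall>\<phi>\<in>a_states a. \<forall>x. cmod (\<phi> x) \<le> K * norm x" and "K \<ge> 0"
    using a_states_uniformly_bounded[OF a] by auto
  have "cmod (al_pair a l \<phi> x y)
      \<le> K * norm (adj x * a * y) + (K * norm (a * x)) * (K * norm (a * y))"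
    if \<phi>: "\<phi> \<in> a_states a" for \<phi>
  proof -
    have "cmod (al_pair a l \<phi> x y)
        \<le> l * cmod (\<phi> (adj x * a * y)) + (1 - l) * (cmod (\<phi> (a * x)) * cmod (\<phi> (a * y)))"
      unfolding al_pair_def using l
      by (intro order_trans[OF norm_triangle_ineq]) (simp add: norm_mult del: of_real_diff)
    also have "\<dots> \<le> 1 * (K * norm (adj x * a * y)) + 1 * ((K * norm (a * x)) * (K * norm (a * y)))"
      using l K \<phi> \<open>K \<ge> 0\<close> by (intro add_mono mult_mono) auto
    finally show ?thesis
      by simp
  qed
  then show ?thesis
    by blast
qed

lemma al_quad_bounded: "\<exists>C. \<forall>\<phi>\<in>a_states a. al_quad a l \<phi> x \<le> C"
proof -
  have "al_quad a l \<phi> x = Re (al_pair a l \<phi> x x)" for \<phi>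
    unfolding al_quad_def al_pair_def cmod_power2 by (simp add: power2_eq_square algebra_simps)
  then have "al_quad a l \<phi> x \<le> cmod (al_pair a l \<phi> x x)" for \<phi>
    by (simp only: complex_Re_le_cmod)
  moreover obtain C where "\<forall>\<phi>\<in>a_states a. cmod (al_pair a l \<phi> x x) \<le> C"
    using al_pair_bounded by blast
  ultimately show ?thesis
    by (intro exI[of _ C]) (blast intro: order_trans)
qed

lemma al_norm_nonneg: "0 \<le> al_norm a l x"
  and al_quad_le_al_norm: "\<phi> \<in> a_states a \<Longrightarrow> al_quad a l \<phi> x \<le> (al_norm a l x)\<^sup>2"
proof -
  obtain C where "\<forall>\<phi>\<in>a_states a. al_quad a l \<phi> x \<le> C"
    using al_quad_bounded by blast
  then have "bdd_above ((\<lambda>\<phi>. sqrt (al_quad a l \<phi> x)) ` a_states a)"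
    by (intro bdd_aboveI2[of _ _ "sqrt C"]) simp
  then have upper: "sqrt (al_quad a l \<phi> x) \<le> al_norm a l x" if "\<phi> \<in> a_states a" for \<phi>
    unfolding al_norm_def al_quad_def[symmetric] by (rule cSUP_upper[OF that])
  obtain \<psi> where \<psi>: "\<psi> \<in> a_states a"
    using a_states_nonempty[OF a] by blast
  have "0 \<le> sqrt (al_quad a l \<psi> x)"
    using al_quad_nonneg[OF \<psi>] by simp
  then show "0 \<le> al_norm a l x"
    using upper[OF \<psi>] by linarith
  show "al_quad a l \<phi> x \<le> (al_norm a l x)\<^sup>2" if "\<phi> \<in> a_states a"
    using upper[OF that] by (rule sqrt_le_D)
qed

text \<open>The supremum defining the norm is approached on the level of squares.\<close>

lemma al_norm_approx:
  assumes "0 < e"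
  shows "\<exists>\<phi>\<in>a_states a. (al_norm a l x)\<^sup>2 - e < al_quad a l \<phi> x"
proof (rule ccontr)
  assume "\<not> ?thesis"
  then have le: "al_quad a l \<phi> x \<le> (al_norm a l x)\<^sup>2 - e" if "\<phi> \<in> a_states a" for \<phi>
    using that by force
  have "al_norm a l x \<le> sqrt ((al_norm a l x)\<^sup>2 - e)"
    unfolding al_norm_def[of a l x, folded al_quad_def]
    by (rule cSUP_least[OF a_states_nonempty[OF a]])
      (use le in \<open>simp add: al_norm_def flip: al_quad_def\<close>)
  moreover obtain \<phi> where \<phi>: "\<phi> \<in> a_states a"
    using a_states_nonempty[OF a] by blast
  have "0 \<le> (al_norm a l x)\<^sup>2 - e"
    using le[OF \<phi>] al_quad_nonneg[OF \<phi>, of x] by linarith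
  ultimately have "(al_norm a l x)\<^sup>2 \<le> (al_norm a l x)\<^sup>2 - e"
    using al_norm_nonneg[of x] by (metis power_mono real_sqrt_pow2)
  then show False
    using assms by simp
qed

text \<open>
  A state \<open>\<phi>\<close> norming \<open>x + t u y\<close> up to \<open>t\<^sup>2\<close> satisfies
  \<open>N - t\<^sup>2 < Q\<^sub>\<phi>(x) + 2 t Re (u B\<^sub>\<phi>(x,y)) + t\<^sup>2 Q\<^sub>\<phi>(y)\<close>, where \<open>N\<close> is the squared norm of \<open>x\<close>. As
  \<open>Q\<^sub>\<phi>(x) \<le> N\<close>, division by \<open>t\<close> bounds the sign term from below by a multiple of \<open>-t\<close>. As the
  last two terms are \<open>O(t)\<close> uniformly in \<open>\<phi>\<close>, also \<open>Q\<^sub>\<phi>(x)\<close> is within \<open>O(t)\<close> of \<open>N\<close>.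
\<close>

lemma al_orthogonal_imp_approx:
  assumes orth: "al_orthogonal a l x y" and u: "cmod u = 1" and e: "0 < e"
  shows "\<exists>\<phi>\<in>a_states a. (al_norm a l x)\<^sup>2 - e \<le> al_quad a l \<phi> x \<and> - e \<le> Re (u * al_pair a l \<phi> x y)"
proof -
  obtain C where C: "\<forall>\<phi>\<in>a_states a. cmod (al_pair a l \<phi> x y) \<le> C"
    using al_pair_bounded by blast
  obtain D where D: "\<forall>\<phi>\<in>a_states a. al_quad a l \<phi> y \<le> D"
    using al_quad_bounded by blast
  define B where "B = max 0 (max C D)"
  have B: "0 \<le> B" "C \<le> B" "D \<le> B"
    by (auto simp: B_def)
  \<comment> \<open>The two errors come out as at most \<open>t (1 + B) / 2\<close> and \<open>t (1 + 3 B)\<close>.\<close>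
  define t where "t = min 1 (e / (1 + 3 * B))"
  have "t \<le> e / (1 + 3 * B)"
    by (simp add: t_def)
  then have "t * (1 + 3 * B) \<le> e"
    using B(1) by (simp add: pos_le_divide_eq)
  moreover have "0 < t" "t \<le> 1"
    using e B(1) by (simp_all add: t_def)
  ultimately have t: "0 < t" "t \<le> 1" "t * (1 + 3 * B) \<le> e"
    by auto
  obtain \<phi> where \<phi>: "\<phi> \<in> a_states a"
      and approx: "(al_norm a l (x + (t * u) *\<^sub>C y))\<^sup>2 - t\<^sup>2 < al_quad a l \<phi> (x + (t * u) *\<^sub>C y)"
    using al_norm_approx[of "t\<^sup>2" "x + (t * u) *\<^sub>C y"] t by auto
  define h where "h = Re (u * al_pair a l \<phi> x y)"
  define q where "q = al_quad a l \<phi> y"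
  define N where "N = (al_norm a l x)\<^sup>2"
  have "N \<le> (al_norm a l (x + (t * u) *\<^sub>C y))\<^sup>2"
    using orth al_norm_nonneg by (auto simp: N_def al_orthogonal_def intro!: power_mono)
  moreover have "Re (t * u * al_pair a l \<phi> x y) = t * h"
    by (simp add: h_def mult.assoc)
  then have "al_quad a l \<phi> (x + (t * u) *\<^sub>C y) = al_quad a l \<phi> x + 2 * (t * h) + t\<^sup>2 * q"
    using al_quad_add[OF positive_elem_adj[OF a(1)] \<phi>, of l x "t * u" y] t u
    by (simp add: norm_mult q_def)
  ultimately have main: "N - t\<^sup>2 < al_quad a l \<phi> x + 2 * (t * h) + t\<^sup>2 * q"
    using approx by linarith
  have "t\<^sup>2 * q \<le> t * (t * B)"
    using D \<phi> B t by (auto simp: q_def power2_eq_square mult.assoc intro!: mult_left_mono)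
  then have main': "N < al_quad a l \<phi> x + 2 * (t * h) + t * (t * (1 + B))"
    using main by (simp add: algebra_simps power2_eq_square)
  have tt: "t * (1 + B) \<le> 1 + B"
    using B t mult_right_mono[of t 1 "1 + B"] by simp
  have "al_quad a l \<phi> x \<le> N"
    unfolding N_def by (rule al_quad_le_al_norm[OF \<phi>])
  then have "0 < t * (2 * h + t * (1 + B))"
    using main' by (simp add: algebra_simps)
  then have "0 < 2 * h + t * (1 + B)"
    using t by (simp add: zero_less_mult_iff)
  moreover have "t * (1 + B) \<le> t * (1 + 3 * B)"
    using B t by (intro mult_left_mono) auto
  ultimately have "- e \<le> h"
    using t e by linarith
  moreover have "h \<le> B"
    using bspec[OF C \<phi>] B complex_Re_le_cmod[of "u * al_pair a l \<phi> x y"] u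
    by (simp add: h_def norm_mult)
  then have "2 * (t * h) + t * (t * (1 + B)) \<le> 2 * (t * B) + t * (1 + B)"
    using t tt by (intro add_mono mult_left_mono) auto
  then have "N - e \<le> al_quad a l \<phi> x"
    using main' t(3) by (simp add: algebra_simps)
  ultimately show ?thesis
    using \<phi> by (auto simp: h_def N_def)
qed

lemma al_orthogonal_imp_state:
  assumes orth: "al_orthogonal a l x y" and u: "cmod u = 1"
  shows "\<exists>\<phi>\<in>a_states a. al_quad a l \<phi> x = (al_norm a l x)\<^sup>2 \<and> 0 \<le> Re (u * al_pair a l \<phi> x y)"
proof -
  define D where "D e = {\<phi>. (al_norm a l x)\<^sup>2 - e \<le> al_quad a l \<phi> x}
      \<inter> {\<phi>. - e \<le> Re (u * al_pair a l \<phi> x y)}" for e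
  have eval: "continuous_on UNIV (\<lambda>\<phi>::'a \<Rightarrow> complex. \<phi> z)" for z
    by (rule continuous_on_product_coordinates)
  have "a_states a \<inter> (\<Inter>e\<in>{0<..}. D e) \<noteq> {}"
  proof (rule compact_imp_fip_image[OF compact_a_states[OF a]])
    show "closed (D e)" for e
      unfolding D_def al_quad_def al_pair_def
      by (intro closed_Int closed_Collect_le continuous_on_const continuous_on_add
          continuous_on_mult continuous_on_Re continuous_on_cnj continuous_on_power
          continuous_on_norm eval)
    fix I :: "real set" assume I: "finite I" "I \<subseteq> {0<..}"
    \<comment> \<open>The sets are nested, so the smallest index decides; the \<open>1\<close> covers empty \<open>I\<close>.\<close>
    define e where "e = Min (insert 1 I)"
    have "0 < e" "\<And>i. i \<in> I \<Longrightarrow> e \<le> i"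
      using I by (auto simp: e_def)
    then obtain \<phi> where "\<phi> \<in> a_states a" "\<phi> \<in> D e"
      using al_orthogonal_imp_approx[OF orth u] by (force simp: D_def)
    moreover have "\<phi> \<in> D i" if "i \<in> I" for i
      using \<open>\<phi> \<in> D e\<close> \<open>\<And>i. i \<in> I \<Longrightarrow> e \<le> i\<close>[OF that] by (auto simp: D_def)
    ultimately show "a_states a \<inter> (\<Inter>i\<in>I. D i) \<noteq> {}"
      by blast
  qed
  then obtain \<phi> where \<phi>: "\<phi> \<in> a_states a" "\<And>e. 0 < e \<Longrightarrow> \<phi> \<in> D e"
    by auto
  have near: "(al_norm a l x)\<^sup>2 \<le> al_quad a l \<phi> x + e"
      "0 \<le> Re (u * al_pair a l \<phi> x y) + e" if "0 < e" for e
    using \<phi>(2)[OF that] unfolding D_def Int_iff mem_Collect_eq by linarith+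
  have "(al_norm a l x)\<^sup>2 \<le> al_quad a l \<phi> x"
    by (rule field_le_epsilon) (rule near)
  moreover have "0 \<le> Re (u * al_pair a l \<phi> x y)"
    by (rule field_le_epsilon) (rule near)
  moreover have "al_quad a l \<phi> x \<le> (al_norm a l x)\<^sup>2"
    by (rule al_quad_le_al_norm[OF \<phi>(1)])
  ultimately show ?thesis
    using \<phi>(1) by (meson order_antisym)
qed

end

theorem theorem4p3:
  fixes a x y :: "'a::unital_cstar_algebra" and l :: real
  assumes "positive_elem a" and "invertible_elem a" and "l \<in> {0..1}"
  shows "al_orthogonal a l x y \<longleftrightarrow>
    (\<forall>\<theta>\<in>{0..<2 * pi}. \<exists>\<phi>\<in>a_states a.
        complex_of_real l * \<phi> (adj x * a * x)
            + complex_of_real ((1 - l) * (cmod (\<phi> (a * x)))\<^sup>2)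
          = complex_of_real ((al_norm a l x)\<^sup>2)
      \<and> Re (exp (\<i> * complex_of_real \<theta>) *
            (complex_of_real l * \<phi> (adj x * a * y)
              + complex_of_real (1 - l) * cnj (\<phi> (a * x)) * \<phi> (a * y))) \<ge> 0)"
proof -
  have norming: "complex_of_real l * \<phi> (adj x * a * x)
        + complex_of_real ((1 - l) * (cmod (\<phi> (a * x)))\<^sup>2) = complex_of_real ((al_norm a l x)\<^sup>2)
      \<longleftrightarrow> al_quad a l \<phi> x = (al_norm a l x)\<^sup>2" if "\<phi> \<in> a_states a" for \<phi>
  proof -
    interpret positive_linear \<phi>
      using that by (simp add: mem_a_states_iff)
    have "\<phi> (adj x * a * x) = complex_of_real (Re (\<phi> (adj x * a * x)))"
      using positive_Im[OF positive_elem_sandwich[OF assms(1,2)]] by (simp add: complex_eq_iff)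
    then have "complex_of_real l * \<phi> (adj x * a * x)
        + complex_of_real ((1 - l) * (cmod (\<phi> (a * x)))\<^sup>2) = complex_of_real (al_quad a l \<phi> x)"
      unfolding al_quad_def by (metis of_real_add of_real_mult)
    then show ?thesis
      by (simp only: of_real_eq_iff)
  qed
  have "al_orthogonal a l x y \<longleftrightarrow> (\<forall>\<theta>\<in>{0..<2 * pi}. \<exists>\<phi>\<in>a_states a.
      al_quad a l \<phi> x = (al_norm a l x)\<^sup>2
      \<and> 0 \<le> Re (exp (\<i> * complex_of_real \<theta>) * al_pair a l \<phi> x y))" (is "_ \<longleftrightarrow> ?states")
  proof
    assume "al_orthogonal a l x y"
    then show ?states
      using al_orthogonal_imp_state[OF assms] by simp
  next
    assume states: ?states
    show "al_orthogonal a l x y"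
      unfolding al_orthogonal_def
    proof
      fix \<xi>
      have "Arg2pi \<xi> \<in> {0..<2 * pi}"
        using Arg2pi by simp
      then obtain \<phi> where \<phi>: "\<phi> \<in> a_states a" "al_quad a l \<phi> x = (al_norm a l x)\<^sup>2"
          and sign: "0 \<le> Re (exp (\<i> * complex_of_real (Arg2pi \<xi>)) * al_pair a l \<phi> x y)"
        using states by blast
      define w where "w = exp (\<i> * complex_of_real (Arg2pi \<xi>)) * al_pair a l \<phi> x y"
      have "\<xi> * al_pair a l \<phi> x y = complex_of_real (cmod \<xi>) * w"
        unfolding w_def by (metis Arg2pi_eq mult.assoc)
      then have "0 \<le> Re (\<xi> * al_pair a l \<phi> x y)"
        using sign by (simp add: w_def[symmetric])
      then have "(al_norm a l x)\<^sup>2 \<le> al_quad a l \<phi> (x + \<xi> *\<^sub>C y)"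
        unfolding al_quad_add[OF positive_elem_adj[OF assms(1)] \<phi>(1)] \<phi>(2)
        by (intro add_increasing2 mult_nonneg_nonneg al_quad_nonneg[OF assms \<phi>(1)]) simp_all
      also have "\<dots> \<le> (al_norm a l (x + \<xi> *\<^sub>C y))\<^sup>2"
        by (rule al_quad_le_al_norm[OF assms \<phi>(1)])
      finally show "al_norm a l x \<le> al_norm a l (x + \<xi> *\<^sub>C y)"
        by (rule power2_le_imp_le) (rule al_norm_nonneg[OF assms])
    qed
  qed
  then show ?thesis
    unfolding al_pair_def by (simp only: norming cong: bex_cong)
qed

end
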